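(* Let $r\geq 2$ and $1\leq i\leq r$ be integers. For every nonnegative integer $n$, $$C_{r,i}(n)=T_{r,i}(n)=E_{r,i}(n).$$
   Context: A partition $\lambda=(\lambda_1,\dots,\lambda_s)$ of $n$ is a non-increasing sequence of positive integers (parts) with sum $n$; $s$ is its length. $T_{r,i}(n)$ is the number of partitions $\lambda=(\lambda_1,\dots,\lambda_s)$ of $n$ such that $\lambda_j-\lambda_{j+r-1}\geq 2$ for all $j$ with $1\le j$ and $j+r-1\leq s$, and at most $i-1$ parts are equal to $1$. $E_{r,i}(n)$ is the number of partitions of $n$ none of whose parts is congruent to $0$, $i$ or $-i$ modulo $2r+1$. For a partition $\lambda=(\lambda_1,\dots,\lambda_s)$, set $\lambda_j:=0$ for $j\leq 0$ and define for $1\le \ell\le r-1$ the numbers $p_{i,\ell}(\lambda)$ by $p_{i,1}(\lambda)=\lambda_s$; $p_{i,\ell}(\lambda)=\lambda_{s-\sum_{j=1}^{\ell-1}p_{i,j}(\lambda)}$ if $2\leq \ell\leq i$; $p_{i,\ell}(\lambda)=\lambda_{s+\ell-i-\sum_{j=1}^{\ell-1}p_{i,j}(\lambda)}$ if $i<\ell\leq r-1$; with the rule that if $p_{i,\ell}(\lambda)=0$ then $p_{i,j}(\lambda)=0$ for all $j>\ell$. Let $N_{r,i}(\lambda)$ be the number of $\ell\in\{1,\dots,r-1\}$ with $p_{i,\ell}(\lambda)\neq 0$. $\mathcal{C}_{r,i}$ is the set of partitions $\lambda=(\lambda_1,\dots,\lambda_s)$ with at most $i-1$ parts equal to $1$ and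 such that either $N_{r,i}(\lambda)<r-1$, or $N_{r,i}(\lambda)=r-1$ and $s\leq \sum_{j=1}^{r-1}p_{i,j}(\lambda)-(r-i)$. $C_{r,i}(n)$ is the number of partitions of $n$ in $\mathcal{C}_{r,i}$. *)

theory Defs
  imports "HOL-Number_Theory.Cong"
begin

definition partition_of :: "nat \<Rightarrow> nat list \<Rightarrow> bool" where
  "partition_of n xs \<longleftrightarrow>
     sorted_wrt (\<ge>) xs \<and> (\<forall>x\<in>set xs. 0 < x) \<and> sum_list xs = n"

lemma finite_partitions_of: "finite {xs. partition_of n xs}"
proof (rule finite_subset)
  have len: "length ys \<le> sum_list ys" if "\<forall>x\<in>set ys. 0 < x" for ys :: "nat list"
    using that by (induction ys) auto
  show "{xs. partition_of n xs} \<subseteq> {ys. set ys \<subseteq> {..n} \<and> length ys \<le> n}"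
    using len by (auto simp: partition_of_def member_le_sum_list)
  show "finite {ys. set ys \<subseteq> {..n} \<and> length ys \<le> n}"
    by (rule finite_lists_length_le) simp
qed

text \<open>Parts \<open>\<lambda>\<^sub>j\<close> are indexed from 1, over the integers, so that \<open>\<lambda>\<^sub>j = 0\<close> for \<open>j \<le> 0\<close>. The value for
  \<open>j\<close> beyond the length is arbitrary: it is never reached below when \<open>i \<ge> 1\<close>.\<close>

definition part :: "nat list \<Rightarrow> int \<Rightarrow> nat" where
  "part xs j = (if 1 \<le> j \<and> j \<le> int (length xs) then xs ! nat (j - 1) else 0)"

definition T_count :: "nat \<Rightarrow> nat \<Rightarrow> nat \<Rightarrow> nat" where
  "T_count r i n = card {xs. partition_of n xs \<and>
     (\<forall>j. 1 \<le> j \<and> j + int r - 1 \<le> int (length xs) \<longrightarrow>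
        int (part xs j) - int (part xs (j + int r - 1)) \<ge> 2) \<and>
     count_list xs 1 \<le> i - 1}"

definition E_count :: "nat \<Rightarrow> nat \<Rightarrow> nat \<Rightarrow> nat" where
  "E_count r i n = card {xs. partition_of n xs \<and>
     (\<forall>x\<in>set xs. \<not> [int x = 0] (mod (2 * int r + 1)) \<and>
        \<not> [int x = int i] (mod (2 * int r + 1)) \<and>
        \<not> [int x = - int i] (mod (2 * int r + 1)))}"

text \<open>The index \<open>l\<close> starts at 1; the value at \<open>l = 0\<close> is a dummy and never used.\<close>

fun p_val :: "nat \<Rightarrow> nat list \<Rightarrow> nat \<Rightarrow> nat" where
  "p_val i xs l =
     (if l = 0 then 0
      else if l = 1 then part xs (int (length xs))
      else if \<exists>j\<in>{1..<l}. p_val i xs j = 0 then 0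
      else if l \<le> i then
        part xs (int (length xs) - int (\<Sum>j\<in>{1..<l}. p_val i xs j))
      else
        part xs (int (length xs) + int l - int i - int (\<Sum>j\<in>{1..<l}. p_val i xs j)))"

declare p_val.simps [simp del]

definition N_val :: "nat \<Rightarrow> nat \<Rightarrow> nat list \<Rightarrow> nat" where
  "N_val r i xs = card {l\<in>{1..r - 1}. p_val i xs l \<noteq> 0}"

definition in_C :: "nat \<Rightarrow> nat \<Rightarrow> nat list \<Rightarrow> bool" where
  "in_C r i xs \<longleftrightarrow> count_list xs 1 \<le> i - 1 \<and>
     (N_val r i xs < r - 1 \<or>
      N_val r i xs = r - 1 \<and>
      int (length xs) \<le> int (\<Sum>j\<in>{1..r - 1}. p_val i xs j) - (int r - int i))"

definition C_count :: "nat \<Rightarrow> nat \<Rightarrow> nat \<Rightarrow> nat" where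
  "C_count r i n = card {xs. partition_of n xs \<and> in_C r i xs}"

end

theory Submission
  imports Defs "HOL-Computational_Algebra.Formal_Power_Series" "HOL-Library.Multiset"
begin

text \<open>
  Put \<open>x = q\<^sup>t\<close> and count Gordon's partitions with all parts greater than \<open>t\<close>. Splitting off the parts
  equal to \<open>t + 1\<close> gives Gordon's recurrence
  \<open>T\<^sub>i(x) - T\<^bsub>i-1\<^esub>(x) = (xq)\<^bsup>i-1\<^esup> T\<^bsub>r-i+1\<^esub>(xq)\<close>, whose solution is unique.

  The condition defining \<open>C\<close> cuts a partition greedily from its smallest part into \<open>i - 1\<close> blocks of \<open>p\<close> parts
  of size at least \<open>p\<close> and \<open>r - i\<close> blocks of \<open>p - 1\<close> such parts. Greedy cutting from the largest part decides
  the same condition, and by Durfee rectangles it yields a multisum for \<open>C\<^sub>i(x)\<close>. Let \<open>A\<^sub>i(x)\<close> be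
  Andrews' multisum, in which squares and rectangles come in the other order. Then
  \<open>C\<^sub>i(x) - C\<^bsub>i-1\<^esub>(x) = (xq)\<^bsup>i-1\<^esup> A\<^bsub>r-i+1\<^esub>(xq)\<close> and
  \<open>A\<^sub>i(x) - A\<^bsub>i-1\<^esub>(x) = (xq)\<^bsup>i-1\<^esup> C\<^bsub>r-i+1\<^esub>(xq)\<close>,
  so the differences from \<open>T\<close> vanish and \<open>A = C = T\<close>.

  Andrews' alternating series \<open>J\<^sub>i(x)\<close> solves Gordon's recurrence as well, and at \<open>x = 1\<close> the Jacobi triple
  product turns it into the generating function of \<open>E\<close>.
\<close>

unbundle fps_syntax

section \<open>Power series modulo a power of the variable\<close>

definition eqm :: "nat \<Rightarrow> int fps \<Rightarrow> int fps \<Rightarrow> bool" where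
  "eqm M f g \<longleftrightarrow> (\<forall>n<M. f $ n = g $ n)"

lemma eqm_refl [simp]: "eqm M f f"
  by (simp add: eqm_def)

lemma eqm_sym: "eqm M f g \<Longrightarrow> eqm M g f"
  by (simp add: eqm_def)

lemma eqm_trans [trans]: "eqm M f g \<Longrightarrow> eqm M g h \<Longrightarrow> eqm M f h"
  by (simp add: eqm_def)

lemma eqm_mono: "eqm M f g \<Longrightarrow> N \<le> M \<Longrightarrow> eqm N f g"
  by (simp add: eqm_def)

lemma eqm_imp_eq: "(\<And>M. eqm M f g) \<Longrightarrow> f = g"
  unfolding eqm_def by (rule fps_ext) blast

lemma eqm_add: "eqm M f f' \<Longrightarrow> eqm M g g' \<Longrightarrow> eqm M (f + g) (f' + g')"
  by (simp add: eqm_def)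

lemma eqm_diff: "eqm M f f' \<Longrightarrow> eqm M g g' \<Longrightarrow> eqm M (f - g) (f' - g')"
  by (simp add: eqm_def)

lemma eqm_mult: "eqm M f f' \<Longrightarrow> eqm M g g' \<Longrightarrow> eqm M (f * g) (f' * g')"
  by (auto simp: eqm_def fps_mult_nth intro!: sum.cong)

lemma eqm_sum: "(\<And>x. x \<in> A \<Longrightarrow> eqm M (f x) (g x)) \<Longrightarrow> eqm M (sum f A) (sum g A)"
  by (auto simp: eqm_def fps_sum_nth intro!: sum.cong)

lemma eqm_X_power_mult: "eqm M f g \<Longrightarrow> eqm (M + k) (fps_X ^ k * f) (fps_X ^ k * g)"
  by (auto simp: eqm_def fps_X_power_mult_nth)

lemma eqm_X_power_mult_0: "M \<le> k \<Longrightarrow> eqm M (fps_X ^ k * f) 0"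
  by (auto simp: eqm_def fps_X_power_mult_nth)

text \<open>Strong induction on the degree: once the lower coefficients of \<open>f - g\<close>
  vanish, the coefficient of \<open>(f - g) * h\<close> is that of \<open>f - g\<close>, because
  \<open>h\<close> has constant term 1.\<close>

lemma eqm_cancel:
  assumes "h $ 0 = 1" "eqm M (f * h) (g * h)"
  shows "eqm M f g"
proof -
  have *: "((f - g) * h) $ n = 0" if "n < M" for n
    using assms(2) that by (simp add: eqm_def algebra_simps)
  have "(f - g) $ n = 0" if "n < M" for n
    using that
  proof (induction n rule: less_induct)
    case (less n)
    have "((f - g) * h) $ n = (\<Sum>k=0..n. (f - g) $ k * h $ (n - k))"
      by (rule fps_mult_nth)
    also have "\<dots> = (\<Sum>k\<in>{n}. (f - g) $ k * h $ (n - k))"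
    proof (rule sum.mono_neutral_right)
      show "\<forall>k\<in>{0..n} - {n}. (f - g) $ k * h $ (n - k) = 0"
      proof
        fix k assume "k \<in> {0..n} - {n}"
        hence "(f - g) $ k = 0" using less.IH[of k] less.prems by auto
        thus "(f - g) $ k * h $ (n - k) = 0" by simp
      qed
    qed auto
    finally show ?case using * less.prems assms(1) by simp
  qed
  thus ?thesis by (simp add: eqm_def)
qed

section \<open>Convergent sequences of power series\<close>

definition stable :: "(nat \<Rightarrow> int fps) \<Rightarrow> bool" where
  "stable F \<longleftrightarrow> (\<forall>M. eqm (Suc M) (F (Suc M)) (F M))"

text \<open>The diagonal is the limit because stability makes \<open>F n\<close> final up to and
  including degree \<open>n\<close>.\<close>

definition flim :: "(nat \<Rightarrow> int fps) \<Rightarrow> int fps" where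
  "flim F = Abs_fps (\<lambda>n. F n $ n)"

lemma stable_eqm:
  assumes "stable F" "M \<le> N"
  shows "eqm (Suc M) (F N) (F M)"
  using assms(2)
proof (induction N rule: dec_induct)
  case (step n)
  have "eqm (Suc M) (F (Suc n)) (F n)"
    using assms(1) step.hyps unfolding stable_def by (meson Suc_le_mono eqm_mono)
  thus ?case using step.IH eqm_trans by blast
qed simp

lemma flim_eqm: "stable F \<Longrightarrow> eqm (Suc M) (flim F) (F M)"
  using stable_eqm[of F] by (fastforce simp: eqm_def flim_def less_Suc_eq_le)

lemma flim_unique:
  assumes "\<And>M. eqm M g (F M)" and "stable F"
  shows "flim F = g"
proof (rule eqm_imp_eq)
  fix M
  have "eqm M (flim F) (F M)"
    using flim_eqm[OF assms(2)] eqm_mono le_SucI by blast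
  thus "eqm M (flim F) g"
    using assms(1) eqm_sym eqm_trans by blast
qed

lemma flim_add: "flim (\<lambda>a. F a + G a) = flim F + flim G"
  by (rule fps_ext) (simp add: flim_def)

lemma flim_mult_left:
  assumes "stable F"
  shows "flim (\<lambda>a. c * F a) = c * flim F"
proof (rule flim_unique)
  show "eqm M (c * flim F) (c * F M)" for M
    using flim_eqm[OF assms] by (meson eqm_mono eqm_mult eqm_refl le_SucI order_refl)
  show "stable (\<lambda>a. c * F a)"
    using assms by (auto simp: stable_def intro: eqm_mult)
qed

lemma stable_Suc: "stable F \<Longrightarrow> stable (\<lambda>a. F (Suc a))"
  unfolding stable_def by (meson eqm_mono le_SucI order_refl)

lemma flim_Suc:
  assumes "stable F"
  shows "flim (\<lambda>a. F (Suc a)) = flim F"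
proof (rule flim_unique)
  show "eqm M (flim F) (F (Suc M))" for M
    using flim_eqm[OF assms, of "Suc M"] eqm_mono by fastforce
qed (use assms stable_Suc in auto)

text \<open>Each application of the recurrence raises \<open>t\<close>, hence gains one power of the variable.\<close>

lemma recurrence_unique:
  fixes d d' :: "nat \<Rightarrow> nat \<Rightarrow> int fps"
  assumes d: "\<And>t. d 0 t = 0"
    "\<And>i t. i < r \<Longrightarrow> d (Suc i) t = d i t + fps_X ^ (Suc t * i) * d' (r - i) (Suc t)"
    "\<And>i t. i \<le> r \<Longrightarrow> eqm (Suc t) (d i t) 0"
  and d': "\<And>t. d' 0 t = 0"
    "\<And>i t. i < r \<Longrightarrow> d' (Suc i) t = d' i t + fps_X ^ (Suc t * i) * d (r - i) (Suc t)"
    "\<And>i t. i \<le> r \<Longrightarrow> eqm (Suc t) (d' i t) 0"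
  and "i \<le> r"
  shows "d i t = 0"
proof -
  \<comment> \<open>Climbing from \<open>c 0 t = 0\<close>, every added term takes \<open>c'\<close>
    at \<open>Suc t\<close>, and the precision known there is already the one claimed for
    \<open>c\<close>. Generic \<open>c\<close> and \<open>c'\<close> allow both families, which feed
    each other, to be treated at once.\<close>
  have step: "eqm (Suc t + Suc k) (c i t) 0"
    if c: "c 0 t = 0"
      "\<And>i. i < r \<Longrightarrow> c (Suc i) t = c i t + fps_X ^ (Suc t * i) * c' (r - i) (Suc t)"
      "\<And>i. i \<le> r \<Longrightarrow> eqm (Suc (Suc t) + k) (c' i (Suc t)) 0" and "i \<le> r"
    for c c' :: "nat \<Rightarrow> nat \<Rightarrow> int fps" and i t k
    using \<open>i \<le> r\<close>
  proof (induction i)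
    case 0
    then show ?case by (simp add: c)
  next
    case (Suc i)
    have "eqm (Suc t + Suc k) (c i t + fps_X ^ (Suc t * i) * c' (r - i) (Suc t))
        (0 + fps_X ^ (Suc t * i) * 0)"
      using Suc c(3)[of "r - i"] by (intro eqm_add eqm_mult) auto
    then show ?case using c(2)[of i] Suc.prems by simp
  qed
  have "\<forall>i t. i \<le> r \<longrightarrow> eqm (Suc t + k) (d i t) 0 \<and> eqm (Suc t + k) (d' i t) 0" for k
  proof (induction k)
    case 0
    then show ?case using d(3) d'(3) by simp
  next
    case (Suc k)
    show ?case
      using step[of d _ d' k] step[of d' _ d k] Suc.IH d(1,2) d'(1,2) by blast
  qed
  hence "eqm M (d i t) 0" for M
    using \<open>i \<le> r\<close> eqm_mono by (metis le_add2)
  thus ?thesis by (rule eqm_imp_eq)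
qed

section \<open>Gaussian binomial coefficients\<close>

text \<open>Defined by a q-Pascal rule, so that no division occurs and \<open>q\<close> may be any
  ring element, later a power of \<open>fps_X\<close>.\<close>

fun qbin :: "'a::comm_ring_1 \<Rightarrow> nat \<Rightarrow> nat \<Rightarrow> 'a" where
  "qbin q n 0 = 1"
| "qbin q 0 (Suc k) = 0"
| "qbin q (Suc n) (Suc k) = qbin q n k + q ^ Suc k * qbin q n (Suc k)"

lemma qbin_eq_0: "n < k \<Longrightarrow> qbin q n k = 0"
  by (induction q n k rule: qbin.induct) auto

lemma qbin_self [simp]: "qbin q n n = 1"
  by (induction n) (auto simp: qbin_eq_0)

text \<open>The other q-Pascal rule. Expanding once by the defining rule and then applying the
  induction hypothesis to both coefficients regroups to the claim.\<close>

lemma qbin_Suc_Suc: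
  "k \<le> n \<Longrightarrow> qbin q (Suc n) (Suc k) = q ^ (n - k) * qbin q n k + qbin q n (Suc k)"
proof (induction n arbitrary: k)
  case 0
  then show ?case by simp
next
  case (Suc n)
  show ?case
  proof (cases k)
    case 0
    then show ?thesis using Suc.IH[of 0] by (simp add: algebra_simps)
  next
    case (Suc k')
    show ?thesis
    proof (cases "k' = n")
      case True
      then show ?thesis using Suc by (simp add: qbin_eq_0)
    next
      case False
      then obtain m where n: "n = k' + Suc m"
        using Suc Suc.prems by (metis Suc_le_mono add_Suc_right le_neq_implies_less less_imp_Suc_add)
      have "qbin q (Suc (Suc n)) (Suc k) = qbin q (Suc n) (Suc k') + q ^ (k' + 2) * qbin q (Suc n) (Suc (Suc k'))"
        by (simp add: Suc)
      also have "qbin q (Suc n) (Suc k') = q ^ (Suc m) * qbin q n k' + qbin q n (Suc k')"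
        using Suc.IH[of k'] n by simp
      also have "qbin q (Suc n) (Suc (Suc k')) = q ^ m * qbin q n (Suc k') + qbin q n (Suc (Suc k'))"
        using Suc.IH[of "Suc k'"] n by simp
      finally show ?thesis
        by (simp add: Suc n algebra_simps power_add)
    qed
  qed
qed

text \<open>Subtracting \<open>q ^ Suc k\<close> times the second q-Pascal rule from the defining
  one cancels the terms with \<open>qbin q n (Suc k)\<close>.\<close>

lemma qbin_absorb: "(1 - q ^ Suc k) * qbin q (Suc n) (Suc k) = (1 - q ^ Suc n) * qbin q n k"
proof (cases "k \<le> n")
  case True
  have "q ^ Suc k * q ^ (n - k) = q ^ Suc n"
    using True by (simp del: power_Suc flip: power_add)
  hence "q ^ Suc k * qbin q (Suc n) (Suc k) = q ^ Suc n * qbin q n k + q ^ Suc k * qbin q n (Suc k)"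
    by (simp only: qbin_Suc_Suc[OF True] distrib_left flip: mult.assoc)
  thus ?thesis by (simp add: algebra_simps)
qed (simp add: qbin_eq_0)

section \<open>The multisums\<close>

text \<open>The factor in front of \<open>f b\<close> generates the partitions with exactly
  \<open>b\<close> parts, all between \<open>b + t\<close> and \<open>a + t\<close>; compare
  \<open>sum_box\<close>.\<close>

definition Sop :: "nat \<Rightarrow> (nat \<Rightarrow> int fps) \<Rightarrow> nat \<Rightarrow> int fps" where
  "Sop t f a = (\<Sum>b\<le>a. fps_X ^ (b\<^sup>2 + t * b) * qbin fps_X a b * f b)"

text \<open>A weighted shift. At \<open>a = 0\<close> the first factor vanishes, so the truncated
  predecessor does no harm.\<close>

definition Pop :: "(nat \<Rightarrow> int fps) \<Rightarrow> nat \<Rightarrow> int fps" where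
  "Pop f a = (1 - fps_X ^ a) * f (a - 1)"

lemma Sop_upto_Suc: "Sop t f a = (\<Sum>b\<le>Suc a. fps_X ^ (b\<^sup>2 + t * b) * qbin fps_X a b * f b)"
  by (simp add: Sop_def qbin_eq_0)

lemma Sop_add: "Sop t (\<lambda>b. f b + g b) a = Sop t f a + Sop t g a"
  by (simp add: Sop_def algebra_simps sum.distrib)

lemma Sop_diff: "Sop t (\<lambda>b. f b - g b) a = Sop t f a - Sop t g a"
  by (simp add: Sop_def algebra_simps sum_subtractf)

lemma Sop_mult_left: "Sop t (\<lambda>b. c * f b) a = c * Sop t f a"
  by (simp add: Sop_def sum_distrib_left mult_ac)

lemma Sop_X_power: "Sop t (\<lambda>b. fps_X ^ b * f b) a = Sop (Suc t) f a"
  by (simp add: Sop_def power_add mult_ac)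

text \<open>The defining q-Pascal rule splits the coefficient. In the part with
  \<open>qbin fps_X a b\<close>, the expansion (b+1)^2 + t(b+1) = b^2 + (t+2)b + (t+1) raises
  \<open>t\<close> by two.\<close>

lemma Sop_Suc:
  "Sop t f (Suc a) = Sop (Suc t) f a + fps_X ^ Suc t * Sop (Suc (Suc t)) (\<lambda>b. f (Suc b)) a"
proof -
  let ?X = "fps_X :: int fps"
  have "Sop t f (Suc a) = f 0 + (\<Sum>b\<le>a. ?X ^ ((Suc b)\<^sup>2 + t * Suc b) * qbin ?X (Suc a) (Suc b) * f (Suc b))"
    by (simp add: Sop_def sum.atMost_Suc_shift del: sum.atMost_Suc qbin.simps(3))
  also have "\<dots> = f 0 + (\<Sum>b\<le>a. ?X ^ ((Suc b)\<^sup>2 + Suc t * Suc b) * qbin ?X a (Suc b) * f (Suc b))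
      + (\<Sum>b\<le>a. ?X ^ ((Suc b)\<^sup>2 + t * Suc b) * qbin ?X a b * f (Suc b))"
    by (simp add: algebra_simps power_add sum.distrib)
  also have "(\<Sum>b\<le>a. ?X ^ ((Suc b)\<^sup>2 + t * Suc b) * qbin ?X a b * f (Suc b))
      = ?X ^ Suc t * Sop (Suc (Suc t)) (\<lambda>b. f (Suc b)) a"
    unfolding Sop_def sum_distrib_left
    by (rule sum.cong) (simp_all add: algebra_simps power2_eq_square power_add)
  also have "f 0 + (\<Sum>b\<le>a. ?X ^ ((Suc b)\<^sup>2 + Suc t * Suc b) * qbin ?X a (Suc b) * f (Suc b)) = Sop (Suc t) f a"
    unfolding Sop_upto_Suc by (simp add: sum.atMost_Suc_shift algebra_simps del: sum.atMost_Suc)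
  finally show ?thesis .
qed

text \<open>The same index shift with the second q-Pascal rule, whose factor q^(a-b) brings t + 2
  down to t + 1. The power in front makes \<open>Sop t f\<close> stable for every
  \<open>f\<close>.\<close>

lemma Sop_Suc_diff:
  "Sop t f (Suc a) - Sop t f a = fps_X ^ (Suc t + a) * Sop (Suc t) (\<lambda>b. f (Suc b)) a"
proof -
  let ?X = "fps_X :: int fps"
  have "Sop t f (Suc a) - Sop t f a =
      (\<Sum>b\<le>a. ?X ^ ((Suc b)\<^sup>2 + t * Suc b) * (qbin ?X (Suc a) (Suc b) - qbin ?X a (Suc b)) * f (Suc b))"
    unfolding Sop_upto_Suc[of t f a] Sop_def[of t f "Suc a"]
    by (simp add: sum.atMost_Suc_shift sum_subtractf[symmetric] algebra_simps
          del: sum.atMost_Suc qbin.simps(3))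
  also have "\<dots> = ?X ^ (Suc t + a) * Sop (Suc t) (\<lambda>b. f (Suc b)) a"
    unfolding Sop_def sum_distrib_left
  proof (rule sum.cong)
    fix b assume "b \<in> {..a}"
    then obtain m where a: "a = b + m" by (auto simp: le_iff_add)
    show "?X ^ ((Suc b)\<^sup>2 + t * Suc b) * (qbin ?X (Suc a) (Suc b) - qbin ?X a (Suc b)) * f (Suc b) =
        ?X ^ (Suc t + a) * (?X ^ (b\<^sup>2 + Suc t * b) * qbin ?X a b * f (Suc b))"
      by (subst qbin_Suc_Suc) (simp_all add: a algebra_simps power2_eq_square power_add)
  qed simp
  finally show ?thesis .
qed

lemma stable_Sop: "stable (Sop t f)"
proof -
  have "eqm (Suc M) (Sop t f M + fps_X ^ (Suc t + M) * Sop (Suc t) (\<lambda>b. f (Suc b)) M) (Sop t f M + 0)" for M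
    by (intro eqm_add eqm_X_power_mult_0) auto
  thus ?thesis
    unfolding stable_def Sop_Suc_diff[symmetric] by simp
qed

text \<open>By \<open>qbin_absorb\<close> the factor 1 - q^b becomes 1 - q^a and leaves the sum;
  shifting the index then raises \<open>t\<close> by two.\<close>

lemma Sop_Pop: "Sop t (Pop f) a = fps_X ^ Suc t * Pop (Sop (Suc (Suc t)) f) a"
proof (cases a)
  case 0
  then show ?thesis by (simp add: Sop_def Pop_def)
next
  case (Suc a')
  let ?X = "fps_X :: int fps"
  have "Sop t (Pop f) a =
      (\<Sum>b\<le>a'. ?X ^ ((Suc b)\<^sup>2 + t * Suc b) * ((1 - ?X ^ Suc b) * qbin ?X (Suc a') (Suc b)) * f b)"
    unfolding Sop_def Suc
    by (simp add: sum.atMost_Suc_shift Pop_def mult_ac del: sum.atMost_Suc qbin.simps(3) power_Suc)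
  also have "\<dots> = (\<Sum>b\<le>a'. ?X ^ Suc t * ((1 - ?X ^ Suc a') * (?X ^ (b\<^sup>2 + Suc (Suc t) * b) * qbin ?X a' b * f b)))"
    unfolding qbin_absorb
    by (rule sum.cong) (simp_all add: power2_eq_square power_add mult_ac)
  finally show ?thesis
    by (simp add: Pop_def Suc Sop_def sum_distrib_left)
qed

text \<open>Raising \<open>t\<close> by one multiplies the summand at \<open>b\<close> by q^b, so
  the difference carries 1 - q^b, which is \<open>Pop\<close> of the shifted sequence.\<close>

lemma Sop_diff_Sop_Suc:
  "Sop t f a - Sop (Suc t) f a = fps_X ^ Suc t * Pop (Sop (Suc (Suc t)) (\<lambda>b. f (Suc b))) a"
proof -
  have "Sop t f a - Sop (Suc t) f a = Sop t (\<lambda>b. f b - fps_X ^ b * f b) a"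
    by (simp add: Sop_diff Sop_X_power)
  also have "(\<lambda>b. f b - fps_X ^ b * f b) = Pop (\<lambda>b. f (Suc b))"
  proof
    show "f b - fps_X ^ b * f b = Pop (\<lambda>b. f (Suc b)) b" for b
      by (cases b) (simp_all add: Pop_def algebra_simps)
  qed
  finally show ?thesis by (simp add: Sop_Pop)
qed

section \<open>Iterated sums, their limits and the crossed recurrences\<close>

lemma stable_funpow_Sop: "stable f \<Longrightarrow> stable ((Sop t ^^ k) f)"
  by (cases k) (auto simp: stable_Sop)

lemma stable_const: "stable (\<lambda>_. c)"
  by (simp add: stable_def)

lemma funpow_Sop_add: "(Sop t ^^ k) (\<lambda>b. f b + g b) = (\<lambda>a. (Sop t ^^ k) f a + (Sop t ^^ k) g a)"
  by (induction k) (auto simp: Sop_add)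

lemma funpow_Sop_mult_left: "(Sop t ^^ k) (\<lambda>b. c * f b) = (\<lambda>a. c * (Sop t ^^ k) f a)"
  by (induction k) (auto simp: Sop_mult_left)

lemma funpow_Sop_Pop: "(Sop t ^^ k) (Pop f) = (\<lambda>a. fps_X ^ (Suc t * k) * Pop ((Sop (Suc (Suc t)) ^^ k) f) a)"
proof (induction k)
  case (Suc k)
  show ?case
    by (rule ext) (simp add: Suc Sop_mult_left Sop_Pop power_add mult_ac)
qed simp

text \<open>Moving the shift inward past the outermost \<open>Sop t\<close> turns that operator into
  \<open>Sop (Suc t)\<close>. This is the passage between neighbouring values of \<open>i\<close> in
  \<open>C_ser\<close>, and the error is the inhomogeneous term of its recurrence.\<close>

lemma shift_Sop_commutator:
  "(Sop t ^^ Suc k) (\<lambda>_. 1) (Suc a) =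
     Sop (Suc t) (\<lambda>b. (Sop t ^^ k) (\<lambda>_. 1) (Suc b)) a
     + fps_X ^ (Suc t * Suc k) * (Sop (Suc (Suc t)) ^^ Suc k) (\<lambda>_. 1) a"
proof (induction k arbitrary: a)
  case 0
  show ?case by (simp add: Sop_Suc)
next
  case (Suc k)
  define g where "g = (Sop t ^^ k) (\<lambda>_. 1)"
  \<comment> \<open>\<open>D\<close> is the error one level down, known by induction. One more
    \<open>Sop t\<close> turns it into \<open>fps_X ^ Suc t * Sop (Suc (Suc t)) D\<close>, by
    \<open>Sop_Suc\<close> and \<open>Sop_Suc_diff\<close>.\<close>
  define D where "D = (\<lambda>a. Sop t g (Suc a) - Sop (Suc t) (\<lambda>b. g (Suc b)) a)"
  have "Sop (Suc t) (\<lambda>b. Sop t g (Suc b)) a - Sop (Suc t) (Sop t g) a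
      = Sop (Suc t) (\<lambda>b. fps_X ^ Suc t * (fps_X ^ b * Sop (Suc t) (\<lambda>b. g (Suc b)) b)) a"
    unfolding Sop_diff[symmetric] Sop_Suc_diff by (simp add: power_add mult_ac)
  also have "\<dots> = fps_X ^ Suc t * Sop (Suc (Suc t)) (Sop (Suc t) (\<lambda>b. g (Suc b))) a"
    by (simp only: Sop_mult_left Sop_X_power)
  finally have 1: "Sop (Suc t) (\<lambda>b. Sop t g (Suc b)) a - Sop (Suc t) (Sop t g) a = \<dots>" .
  have D: "D = (\<lambda>a. fps_X ^ (Suc t * Suc k) * (Sop (Suc (Suc t)) ^^ Suc k) (\<lambda>_. 1) a)"
    unfolding D_def g_def using Suc.IH by (simp add: algebra_simps)
  have "Sop t (Sop t g) (Suc a) - Sop (Suc t) (\<lambda>b. Sop t g (Suc b)) a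
      = fps_X ^ Suc t * Sop (Suc (Suc t)) D a"
    unfolding D_def Sop_diff Sop_Suc[of t "Sop t g"] using 1 by (simp add: algebra_simps)
  also have "\<dots> = fps_X ^ (Suc t * Suc (Suc k)) * (Sop (Suc (Suc t)) ^^ Suc (Suc k)) (\<lambda>_. 1) a"
    unfolding D by (simp add: Sop_mult_left power_add mult_ac)
  finally show ?case
    by (simp add: g_def algebra_simps)
qed

text \<open>With \<open>x = q\<^sup>t\<close>, \<open>A_ser\<close> is Andrews' sum of
  \<open>x\<^bsup>N\<^sub>1+\<dots>+N\<^sub>r\<^sub>-\<^sub>1\<^esup> q\<^bsup>N\<^sub>1\<^sup>2+\<dots>+N\<^sub>r\<^sub>-\<^sub>1\<^sup>2+N\<^sub>i+\<dots>+N\<^sub>r\<^sub>-\<^sub>1\<^esup> / ((q)\<^bsub>N\<^sub>1-N\<^sub>2\<^esub> \<dots> (q)\<^bsub>N\<^sub>r\<^sub>-\<^sub>1\<^esub>)\<close>,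
  one application of \<open>Sop\<close> for each summation variable. The case \<open>i = 0\<close> is the start of the recurrence.\<close>

definition A_ser :: "nat \<Rightarrow> nat \<Rightarrow> nat \<Rightarrow> int fps" where
  "A_ser r i t = (case i of 0 \<Rightarrow> 0 | Suc k \<Rightarrow> flim ((Sop t ^^ k) ((Sop (Suc t) ^^ (r - i)) (\<lambda>_. 1))))"

text \<open>At \<open>t = 0\<close> the argument \<open>Suc a\<close> records that behind a
  rectangle of \<open>a\<close> parts of size at least \<open>a + 1\<close> the remaining parts may
  still be as large as \<open>a + 1\<close>.\<close>

definition C_ser :: "nat \<Rightarrow> nat \<Rightarrow> nat \<Rightarrow> int fps" where
  "C_ser r i t = (case i of 0 \<Rightarrow> 0 | Suc k \<Rightarrow>
     flim ((Sop (Suc t) ^^ (r - i)) (\<lambda>a. (Sop t ^^ k) (\<lambda>_. 1) (Suc a))))"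

lemma C_ser_rec:
  assumes "i < r"
  shows "C_ser r (Suc i) t = C_ser r i t + fps_X ^ (Suc t * i) * A_ser r (r - i) (Suc t)"
proof -
  obtain m where r: "r = Suc (i + m)" using assms less_imp_Suc_add by blast
  show ?thesis
  proof (cases i)
    case 0
    then show ?thesis using r by (simp add: C_ser_def A_ser_def)
  next
    case (Suc k)
    have "C_ser r (Suc i) t = flim ((Sop (Suc t) ^^ m) (\<lambda>a. (Sop t ^^ Suc k) (\<lambda>_. 1) (Suc a)))"
      by (simp add: C_ser_def r Suc)
    also have "(Sop (Suc t) ^^ m) (\<lambda>a. (Sop t ^^ Suc k) (\<lambda>_. 1) (Suc a)) =
       (\<lambda>a. (Sop (Suc t) ^^ m) (Sop (Suc t) (\<lambda>b. (Sop t ^^ k) (\<lambda>_. 1) (Suc b))) a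
          + fps_X ^ (Suc t * Suc k) * (Sop (Suc t) ^^ m) ((Sop (Suc (Suc t)) ^^ Suc k) (\<lambda>_. 1)) a)"
      unfolding shift_Sop_commutator by (simp only: funpow_Sop_add funpow_Sop_mult_left)
    also have "flim \<dots> = C_ser r i t + fps_X ^ (Suc t * i) * A_ser r (r - i) (Suc t)"
      unfolding flim_add
      by (subst flim_mult_left)
         (auto intro!: stable_funpow_Sop stable_const simp: C_ser_def A_ser_def r Suc funpow_swap1 stable_Sop)
    finally show ?thesis .
  qed
qed

lemma eqm_Pop_Suc:
  assumes "stable f"
  shows "eqm (Suc M) (flim f) (Pop f (Suc M))"
proof -
  have "eqm (Suc M) (f M - fps_X ^ Suc M * f M) (f M - 0)"
    by (intro eqm_diff eqm_X_power_mult_0) auto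
  hence "eqm (Suc M) (Pop f (Suc M)) (f M)"
    by (simp add: Pop_def algebra_simps)
  thus ?thesis using flim_eqm[OF assms, of M] eqm_sym eqm_trans by blast
qed

lemma stable_Pop_Suc:
  assumes "stable f"
  shows "stable (\<lambda>a. Pop f (Suc a))"
  unfolding stable_def
proof
  fix M
  have "eqm (Suc M) (flim f) (Pop f (Suc (Suc M)))"
    using eqm_Pop_Suc[OF assms, of "Suc M"] eqm_mono le_SucI by blast
  thus "eqm (Suc M) (Pop f (Suc (Suc M))) (Pop f (Suc M))"
    using eqm_Pop_Suc[OF assms, of M] eqm_sym eqm_trans by blast
qed

lemma flim_Pop: "stable f \<Longrightarrow> flim (\<lambda>a. Pop f (Suc a)) = flim f"
  by (rule flim_unique) (meson eqm_Pop_Suc eqm_mono le_SucI order_refl, rule stable_Pop_Suc)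

text \<open>Neighbouring values of \<open>i\<close> differ in the innermost \<open>Sop t\<close>.
  Replacing it by \<open>Sop (Suc t)\<close> costs a \<open>Pop\<close> term, which
  \<open>funpow_Sop_Pop\<close> carries out through the remaining operators; in the limit
  \<open>Pop\<close> disappears.\<close>

lemma A_ser_rec:
  assumes "i < r"
  shows "A_ser r (Suc i) t = A_ser r i t + fps_X ^ (Suc t * i) * C_ser r (r - i) (Suc t)"
proof -
  obtain m where r: "r = Suc (i + m)" using assms less_imp_Suc_add by blast
  \<comment> \<open>The limit is taken along \<open>Suc a\<close>, because \<open>Pop f\<close>
    vanishes at 0 and need not be stable from the start.\<close>
  have shift: "flim F = flim G + c * flim f"
    if "\<And>a. F a = G a + c * Pop f a" "stable F" "stable G" "stable f" for F G f c
  proof -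
    have "stable (\<lambda>a. Pop f (Suc a))"
      using that(4) by (rule stable_Pop_Suc)
    hence "flim (\<lambda>a. F (Suc a)) = flim (\<lambda>a. G (Suc a)) + c * flim f"
      unfolding that(1) flim_add by (simp add: flim_mult_left flim_Pop that(4))
    thus ?thesis using flim_Suc[OF that(2)] flim_Suc[OF that(3)] by simp
  qed
  show ?thesis
  proof (cases i)
    case 0
    have "flim (\<lambda>a. (Sop (Suc t) ^^ m) (\<lambda>_. 1) (Suc a)) = flim ((Sop (Suc t) ^^ m) (\<lambda>_. 1))"
      by (intro flim_Suc stable_funpow_Sop stable_const)
    then show ?thesis using 0 r by (simp add: C_ser_def A_ser_def)
  next
    case (Suc k)
    define g where "g = (Sop (Suc t) ^^ m) (\<lambda>_. 1)"
    have "(Sop t ^^ k) (Sop t g) a = (Sop t ^^ k) (Sop (Suc t) g) a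
        + fps_X ^ (Suc t * Suc k) * Pop ((Sop (Suc (Suc t)) ^^ k) (Sop (Suc (Suc t)) (\<lambda>b. g (Suc b)))) a" for a
    proof -
      have "Sop t g = (\<lambda>a. Sop (Suc t) g a + fps_X ^ Suc t * Pop (Sop (Suc (Suc t)) (\<lambda>b. g (Suc b))) a)"
        using Sop_diff_Sop_Suc[of t g] by (simp add: fun_eq_iff algebra_simps)
      hence "(Sop t ^^ k) (Sop t g) a = (Sop t ^^ k) (Sop (Suc t) g) a
         + fps_X ^ Suc t * (fps_X ^ (Suc t * k) * Pop ((Sop (Suc (Suc t)) ^^ k) (Sop (Suc (Suc t)) (\<lambda>b. g (Suc b)))) a)"
        by (simp only: funpow_Sop_add funpow_Sop_mult_left funpow_Sop_Pop)
      thus ?thesis by (simp add: power_add mult_ac)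
    qed
    from shift[OF this]
    have "flim ((Sop t ^^ k) (Sop t g)) = flim ((Sop t ^^ k) (Sop (Suc t) g)) +
      fps_X ^ (Suc t * Suc k) * flim ((Sop (Suc (Suc t)) ^^ k) (Sop (Suc (Suc t)) (\<lambda>b. g (Suc b))))"
      by (simp add: stable_funpow_Sop stable_Sop)
    then show ?thesis
      by (simp add: A_ser_def C_ser_def r Suc g_def funpow_swap1)
  qed
qed

text \<open>A summand with \<open>b > 0\<close> carries a power of degree at least
  \<open>1 + t\<close>, so only \<open>b = 0\<close> contributes.\<close>

lemma eqm_Sop:
  assumes "\<And>a. eqm (Suc s) (f a) 1" "s \<le> t"
  shows "eqm (Suc s) (Sop t f a) 1"
proof -
  have "eqm (Suc s) (\<Sum>b\<le>a. fps_X ^ (b\<^sup>2 + t * b) * qbin fps_X a b * f b) (\<Sum>b\<le>a. if b = 0 then 1 else 0)"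
  proof (rule eqm_sum)
    fix b
    show "eqm (Suc s) (fps_X ^ (b\<^sup>2 + t * b) * qbin fps_X a b * f b) (if b = 0 then 1 else 0)"
    proof (cases b)
      case (Suc k)
      have "Suc s \<le> b\<^sup>2 + t * b" using assms(2) by (simp add: Suc power2_eq_square)
      then show ?thesis by (simp add: Suc mult.assoc eqm_X_power_mult_0)
    qed (use assms in auto)
  qed
  thus ?thesis by (simp add: Sop_def)
qed

lemma eqm_funpow_Sop:
  "(\<And>a. eqm (Suc s) (f a) 1) \<Longrightarrow> s \<le> t \<Longrightarrow> eqm (Suc s) ((Sop t ^^ k) f a) 1"
  by (induction k arbitrary: a) (auto intro: eqm_Sop)

lemma eqm_flim: "(\<And>a. eqm M (F a) g) \<Longrightarrow> eqm M (flim F) g"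
  by (simp add: eqm_def flim_def)

lemma A_ser_eqm_1: "0 < i \<Longrightarrow> eqm (Suc t) (A_ser r i t) 1"
  by (cases i) (auto simp: A_ser_def intro!: eqm_flim eqm_funpow_Sop)

lemma C_ser_eqm_1: "0 < i \<Longrightarrow> eqm (Suc t) (C_ser r i t) 1"
  by (cases i) (auto simp: C_ser_def intro!: eqm_flim eqm_funpow_Sop)

lemma C_ser_unique:
  assumes "\<And>t. T 0 t = 0"
    "\<And>i t. i < r \<Longrightarrow> T (Suc i) t = T i t + fps_X ^ (Suc t * i) * T (r - i) (Suc t)"
    "\<And>i t. 0 < i \<Longrightarrow> i \<le> r \<Longrightarrow> eqm (Suc t) (T i t) 1"
  and "i \<le> r"
  shows "C_ser r i t = T i t"
proof -
  have *: "eqm (Suc t) (f i t - T i t) 0"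
    if "f 0 t = 0" "0 < i \<Longrightarrow> eqm (Suc t) (f i t) 1" "i \<le> r" for f i t
    using eqm_diff[of "Suc t" "f i t" 1 "T i t" 1] that assms by (cases "i = 0") auto
  have "C_ser r i t - T i t = 0"
  proof (rule recurrence_unique[where d = "\<lambda>i t. C_ser r i t - T i t" and d' = "\<lambda>i t. A_ser r i t - T i t" and r = r])
    show "eqm (Suc t) (C_ser r i t - T i t) 0" if "i \<le> r" for i t
      using that C_ser_eqm_1 by (intro *) (auto simp: C_ser_def)
    show "eqm (Suc t) (A_ser r i t - T i t) 0" if "i \<le> r" for i t
      using that A_ser_eqm_1 by (intro *) (auto simp: A_ser_def)
  qed (use assms in \<open>auto simp: C_ser_def[of r 0] A_ser_def[of r 0] C_ser_rec A_ser_rec algebra_simps\<close>)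
  thus ?thesis by simp
qed

section \<open>Partitions as multisets\<close>

lemma sorted_desc_eqI:
  fixes xs ys :: "nat list"
  assumes "sorted_wrt (\<ge>) xs" "sorted_wrt (\<ge>) ys" "mset xs = mset ys"
  shows "xs = ys"
proof -
  have "sorted (rev xs)" "sorted (rev ys)"
    using assms by (simp_all add: sorted_wrt_rev)
  hence "rev xs = rev ys"
    using assms(3) by (metis mset_rev properties_for_sort)
  thus ?thesis by simp
qed

lemma nth_mono_desc: "sorted_wrt (\<ge>) xs \<Longrightarrow> k \<le> l \<Longrightarrow> l < length xs \<Longrightarrow> xs ! l \<le> (xs ! k :: nat)"
  by (cases "k = l") (auto simp: sorted_wrt_iff_nth_less)

lemma mset_image_partitions:
  "mset ` {xs. partition_of n xs \<and> P (mset xs)} = {M. 0 \<notin># M \<and> sum_mset M = n \<and> P M}"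
proof (intro equalityI subsetI)
  fix M assume M: "M \<in> {M. 0 \<notin># M \<and> sum_mset M = n \<and> P M}"
  define xs where "xs = rev (sorted_list_of_multiset M)"
  have xs: "mset xs = M" by (simp add: xs_def)
  have "sorted_wrt (\<ge>) xs" by (simp add: xs_def sorted_wrt_rev)
  hence "partition_of n xs"
    using M by (auto simp: partition_of_def simp flip: xs sum_mset_sum_list intro: Nat.gr0I)
  thus "M \<in> mset ` {xs. partition_of n xs \<and> P (mset xs)}"
    using M xs by (metis (mono_tags, lifting) image_eqI mem_Collect_eq)
qed (auto simp: partition_of_def sum_mset_sum_list)

lemma card_partitions:
  "card {xs. partition_of n xs \<and> P (mset xs)} = card {M. 0 \<notin># M \<and> sum_mset M = n \<and> P M}"
  unfolding mset_image_partitions[symmetric]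
  by (rule card_image[symmetric], rule inj_onI) (simp add: partition_of_def sorted_desc_eqI)

lemma finite_multisets_sum: "finite {M. 0 \<notin># M \<and> sum_mset M = (n::nat)}"
  using finite_imageI[OF finite_partitions_of, of mset n] mset_image_partitions[of n "\<lambda>_. True"] by simp

section \<open>Gordon's partitions\<close>

lemma length_filter_two:
  "length (filter (\<lambda>x. x = v \<or> x = Suc v) xs) = count_list xs v + count_list xs (Suc v)"
  by (induction xs) auto

text \<open>In a non-increasing list the entries with value \<open>v\<close> or \<open>v + 1\<close>
  occupy consecutive positions, so a window of \<open>r\<close> entries that violates the gap
  condition is the same as \<open>r\<close> entries with two adjacent values.\<close>

lemma gap_iff_counts:
  assumes "sorted_wrt (\<ge>) (xs :: nat list)" "0 < r"
  shows "(\<forall>j. j + r \<le> length xs \<longrightarrow> xs ! (j + r - 1) + 2 \<le> xs ! j) \<longleftrightarrow>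
         (\<forall>v. count_list xs v + count_list xs (Suc v) < r)"
proof
  assume gap: "\<forall>j. j + r \<le> length xs \<longrightarrow> xs ! (j + r - 1) + 2 \<le> xs ! j"
  show "\<forall>v. count_list xs v + count_list xs (Suc v) < r"
  proof (rule allI, rule ccontr)
    fix v
    assume *: "\<not> count_list xs v + count_list xs (Suc v) < r"
    define K where "K = {k. k < length xs \<and> (xs ! k = v \<or> xs ! k = Suc v)}"
    have K: "finite K" "r \<le> card K"
      using * unfolding K_def length_filter_two[symmetric] length_filter_conv_card by auto
    hence ne: "K \<noteq> {}" using assms(2) by auto
    \<comment> \<open>The first and last positions of the two values. They are at least
      \<open>r - 1\<close> apart, so the window of length \<open>r\<close> starting at
      \<open>a\<close> ends no later than \<open>b\<close>.\<close>
    define a b where "a = Min K" and "b = Max K"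
    have ab: "a \<in> K" "b \<in> K" "K \<subseteq> {a..b}"
      using K ne by (auto simp: a_def b_def)
    have "r \<le> card {a..b}" using K ab card_mono[of "{a..b}" K] by simp
    hence le: "a + r - 1 \<le> b" using assms(2) by auto
    have b: "b < length xs" using ab by (simp add: K_def)
    have "xs ! b \<le> xs ! (a + r - 1)"
      using assms(1) le b by (rule nth_mono_desc)
    moreover have "xs ! a \<le> xs ! b + 1" using ab by (auto simp: K_def)
    moreover have "xs ! (a + r - 1) + 2 \<le> xs ! a" using gap le b assms(2) by auto
    ultimately show False by simp
  qed
next
  assume cnt: "\<forall>v. count_list xs v + count_list xs (Suc v) < r"
  show "\<forall>j. j + r \<le> length xs \<longrightarrow> xs ! (j + r - 1) + 2 \<le> xs ! j"
  proof (intro allI impI, rule ccontr)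
    fix j assume j: "j + r \<le> length xs" and *: "\<not> xs ! (j + r - 1) + 2 \<le> xs ! j"
    define v where "v = xs ! (j + r - 1)"
    have "{j..<j + r} \<subseteq> {k. k < length xs \<and> (xs ! k = v \<or> xs ! k = Suc v)}"
    proof
      fix k assume k: "k \<in> {j..<j + r}"
      have "v \<le> xs ! k" "xs ! k \<le> xs ! j"
        unfolding v_def using k j by (auto intro!: nth_mono_desc[OF assms(1)])
      thus "k \<in> {k. k < length xs \<and> (xs ! k = v \<or> xs ! k = Suc v)}"
        using * k j by (auto simp: v_def)
    qed
    from card_mono[OF _ this] have "r \<le> count_list xs v + count_list xs (Suc v)"
      unfolding length_filter_two[symmetric] length_filter_conv_card by simp
    thus False using cnt by (simp add: linorder_not_less[symmetric])
  qed
qed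

lemma gap_part_iff:
  assumes "0 < r"
  shows "(\<forall>j. 1 \<le> j \<and> j + int r - 1 \<le> int (length xs) \<longrightarrow>
      int (part xs j) - int (part xs (j + int r - 1)) \<ge> 2) \<longleftrightarrow>
    (\<forall>j. j + r \<le> length xs \<longrightarrow> xs ! (j + r - 1) + 2 \<le> xs ! j)" (is "?L \<longleftrightarrow> ?R")
proof
  assume ?L
  show ?R
  proof (intro allI impI)
    fix j assume j: "j + r \<le> length xs"
    have "nat (int j + int r - 1) = j + r - 1" using assms by simp
    thus "xs ! (j + r - 1) + 2 \<le> xs ! j"
      using \<open>?L\<close>[rule_format, of "int j + 1"] j assms by (simp add: part_def)
  qed
next
  assume ?R
  show ?L
  proof (intro allI impI)
    fix j assume j: "1 \<le> j \<and> j + int r - 1 \<le> int (length xs)"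
    then obtain k where k: "j = int k + 1"
      by (metis add.commute le_iff_diff_le_0 zle_iff_zadd)
    have "nat (int k + int r - 1) = k + r - 1" using assms by simp
    thus "int (part xs j) - int (part xs (j + int r - 1)) \<ge> 2"
      using \<open>?R\<close>[rule_format, of k] j assms by (simp add: part_def k)
  qed
qed

text \<open>The gap condition in terms of multiplicities. The strict bound by \<open>i\<close> makes
  the set empty at \<open>i = 0\<close>, as the start of the recurrence demands.\<close>

definition gordon :: "nat \<Rightarrow> nat \<Rightarrow> nat \<Rightarrow> nat \<Rightarrow> nat multiset set" where
  "gordon r i t n = {M. (\<forall>x\<in>#M. t < x) \<and> sum_mset M = n \<and>
     (\<forall>v. count M v + count M (Suc v) < r) \<and> count M (Suc t) < i}"

definition T_ser :: "nat \<Rightarrow> nat \<Rightarrow> nat \<Rightarrow> int fps" where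
  "T_ser r i t = Abs_fps (\<lambda>n. int (card (gordon r i t n)))"

lemma finite_gordon: "finite (gordon r i t n)"
  by (rule finite_subset[OF _ finite_multisets_sum[of n]]) (auto simp: gordon_def)

lemma T_count_eq:
  assumes "0 < r" "0 < i"
  shows "int (T_count r i n) = T_ser r i 0 $ n"
proof -
  have "{xs. partition_of n xs \<and>
     (\<forall>j. 1 \<le> j \<and> j + int r - 1 \<le> int (length xs) \<longrightarrow>
        int (part xs j) - int (part xs (j + int r - 1)) \<ge> 2) \<and> count_list xs 1 \<le> i - 1}
    = {xs. partition_of n xs \<and>
     (\<lambda>M. (\<forall>v. count M v + count M (Suc v) < r) \<and> count M (Suc 0) < i) (mset xs)}"
    unfolding gap_part_iff[OF assms(1)] count_mset
    using gap_iff_counts[OF _ assms(1)] assms(2)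
    by (auto simp: partition_of_def)
  moreover have "gordon r i 0 n = {M. 0 \<notin># M \<and> sum_mset M = n \<and>
      (\<lambda>M. (\<forall>v. count M v + count M (Suc v) < r) \<and> count M (Suc 0) < i) M}"
    by (auto simp: gordon_def intro: Nat.gr0I)
  ultimately show ?thesis
    unfolding T_count_def T_ser_def
    using card_partitions[of n "\<lambda>M. (\<forall>v. count M v + count M (Suc v) < r) \<and> count M (Suc 0) < i"]
    by (simp only: fps_nth_Abs_fps)
qed

text \<open>Taking away the \<open>i\<close> copies of \<open>t + 1\<close> turns the condition at
  \<open>v = t + 1\<close> into the bound \<open>r - i\<close> on the copies of
  \<open>t + 2\<close>.\<close>

lemma gordon_exact:
  assumes "i < r"
  shows "{M \<in> gordon r (Suc i) t n. count M (Suc t) = i} =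
    (if n < Suc t * i then {} else (\<lambda>N. N + replicate_mset i (Suc t)) ` gordon r (r - i) (Suc t) (n - Suc t * i))"
proof -
  have sum_rep: "sum_mset (replicate_mset i (Suc t)) = Suc t * i"
    by (simp add: sum_mset_replicate_mset)
  have fwd: "\<exists>N. M = N + replicate_mset i (Suc t) \<and> Suc t * i \<le> n \<and> N \<in> gordon r (r - i) (Suc t) (n - Suc t * i)"
    if M: "M \<in> gordon r (Suc i) t n" "count M (Suc t) = i" for M
  proof -
    define N where "N = filter_mset (\<lambda>x. x \<noteq> Suc t) M"
    have MN: "M = N + replicate_mset i (Suc t)"
      using M(2) by (intro multiset_eqI) (auto simp: N_def)
    have "sum_mset N + Suc t * i = n"
      using M(1) sum_rep MN by (metis (mono_tags, lifting) gordon_def mem_Collect_eq sum_mset.union)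
    moreover have "\<forall>x\<in>#N. Suc t < x"
      using M(1) by (auto simp: gordon_def N_def intro: le_neq_trans)
    moreover have "count N v + count N (Suc v) < r" for v
      
    proof -
      have "count M v + count M (Suc v) < r" using M(1) by (simp add: gordon_def)
      moreover have "count N v \<le> count M v" "count N (Suc v) \<le> count M (Suc v)"
        by (simp_all add: N_def)
      ultimately show ?thesis by linarith
    qed
    moreover have "count N (Suc (Suc t)) < r - i"
    proof -
      have "count M (Suc t) + count M (Suc (Suc t)) < r" using M(1) by (simp add: gordon_def)
      thus ?thesis using M(2) by (simp add: N_def)
    qed
    ultimately show ?thesis
      using MN by (intro exI[of _ N]) (auto simp: gordon_def)
  qed
  have bwd: "N + replicate_mset i (Suc t) \<in> {M \<in> gordon r (Suc i) t n. count M (Suc t) = i}"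
    if "Suc t * i \<le> n" and N: "N \<in> gordon r (r - i) (Suc t) (n - Suc t * i)" for N
  proof -
    have gt: "\<forall>x\<in>#N. Suc t < x" using N by (simp add: gordon_def)
    hence c0: "count N t = 0" "count N (Suc t) = 0"
      by (auto simp: not_in_iff[symmetric])
    have "count (N + replicate_mset i (Suc t)) v + count (N + replicate_mset i (Suc t)) (Suc v) < r" for v
    proof -
      \<comment> \<open>Only these two values of \<open>v\<close> involve the added copies of
        \<open>t + 1\<close>.\<close>
      consider "v = t" | "v = Suc t" | "v \<noteq> t" "v \<noteq> Suc t" by blast
      thus ?thesis
        by cases (use N assms c0 in \<open>auto simp: gordon_def\<close>)
    qed
    thus ?thesis
      using that(1) N gt c0 sum_rep by (auto simp: gordon_def)
  qed
  show ?thesis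
  proof (intro equalityI subsetI)
    fix M assume "M \<in> {M \<in> gordon r (Suc i) t n. count M (Suc t) = i}"
    thus "M \<in> (if n < Suc t * i then {} else (\<lambda>N. N + replicate_mset i (Suc t)) ` gordon r (r - i) (Suc t) (n - Suc t * i))"
      using fwd[of M] by (auto simp: linorder_not_less[symmetric])
  next
    fix M assume "M \<in> (if n < Suc t * i then {} else (\<lambda>N. N + replicate_mset i (Suc t)) ` gordon r (r - i) (Suc t) (n - Suc t * i))"
    thus "M \<in> {M \<in> gordon r (Suc i) t n. count M (Suc t) = i}"
      using bwd by (cases "n < Suc t * i") (auto simp only: linorder_not_less if_True if_False empty_iff)
  qed
qed

lemma T_ser_rec:
  assumes "i < r"
  shows "T_ser r (Suc i) t = T_ser r i t + fps_X ^ (Suc t * i) * T_ser r (r - i) (Suc t)"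
proof (rule fps_ext)
  fix n
  let ?B = "{M \<in> gordon r (Suc i) t n. count M (Suc t) = i}"
  have "gordon r (Suc i) t n = gordon r i t n \<union> ?B"
    by (auto simp: gordon_def)
  hence "card (gordon r (Suc i) t n) = card (gordon r i t n \<union> ?B)" by simp
  also have "\<dots> = card (gordon r i t n) + card ?B"
    by (rule card_Un_disjoint) (auto simp: finite_gordon, auto simp: gordon_def)
  also have "card ?B = (if n < Suc t * i then 0 else card (gordon r (r - i) (Suc t) (n - Suc t * i)))"
    unfolding gordon_exact[OF assms] by (auto intro!: card_image simp: inj_on_def)
  finally show "T_ser r (Suc i) t $ n = (T_ser r i t + fps_X ^ (Suc t * i) * T_ser r (r - i) (Suc t)) $ n"
    by (simp add: T_ser_def fps_X_power_mult_nth)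
qed

lemma T_ser_0: "T_ser r 0 t = 0"
  by (rule fps_ext) (simp add: T_ser_def gordon_def)

lemma member_le_sum_mset: "x \<in># M \<Longrightarrow> x \<le> sum_mset (M :: nat multiset)"
  by (induction M) auto

lemma T_ser_eqm_1:
  assumes "0 < r" "0 < i"
  shows "eqm (Suc t) (T_ser r i t) 1"
proof -
  have "gordon r i t n = (if n = 0 then {{#}} else {})" if "n \<le> t" for n
  proof -
    have "M = {#} \<and> n = 0" if M: "M \<in> gordon r i t n" for M
    proof -
      have "x \<notin># M" for x
        using M \<open>n \<le> t\<close> member_le_sum_mset[of x M] by (auto simp: gordon_def)
      hence "M = {#}" by (simp add: multiset_eq_iff not_in_iff)
      thus ?thesis using M by (simp add: gordon_def)
    qed
    moreover have "{#} \<in> gordon r i t 0" using assms by (simp add: gordon_def)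
    ultimately show ?thesis by auto
  qed
  thus ?thesis by (auto simp: eqm_def T_ser_def)
qed

lemma C_ser_eq_T_ser: "0 < r \<Longrightarrow> i \<le> r \<Longrightarrow> C_ser r i t = T_ser r i t"
  by (rule C_ser_unique[where T = "T_ser r"]) (simp_all only: T_ser_0 T_ser_rec T_ser_eqm_1)

section \<open>Partitions with parts in a given set\<close>

definition parts_in :: "nat set \<Rightarrow> nat \<Rightarrow> nat multiset set" where
  "parts_in S n = {M. set_mset M \<subseteq> S \<and> sum_mset M = n}"

definition parts_ser :: "nat set \<Rightarrow> int fps" where
  "parts_ser S = Abs_fps (\<lambda>n. int (card (parts_in S n)))"

lemma finite_parts_in: "0 \<notin> S \<Longrightarrow> finite (parts_in S n)"
  by (rule finite_subset[OF _ finite_multisets_sum[of n]]) (auto simp: parts_in_def)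

lemma parts_in_insert:
  assumes "m \<notin> S"
  shows "parts_in (insert m S) n =
    parts_in S n \<union> (if n < m then {} else add_mset m ` parts_in (insert m S) (n - m))"
proof (intro equalityI subsetI)
  fix M assume M: "M \<in> parts_in (insert m S) n"
  show "M \<in> parts_in S n \<union> (if n < m then {} else add_mset m ` parts_in (insert m S) (n - m))"
  proof (cases "m \<in># M")
    case True
    then obtain N where "M = add_mset m N" by (metis insert_DiffM)
    thus ?thesis using M by (auto simp: parts_in_def)
  qed (use M in \<open>auto simp: parts_in_def\<close>)
qed (auto simp: parts_in_def split: if_splits)

text \<open>A partition either avoids \<open>m\<close> or arises by adding one copy of
  \<open>m\<close>, which is the geometric series in recursive form.\<close>

lemma parts_ser_insert:
  assumes "m \<notin> S" "0 < m" "0 \<notin> S"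
  shows "parts_ser (insert m S) * (1 - fps_X ^ m) = parts_ser S"
proof -
  have "parts_ser (insert m S) = parts_ser S + fps_X ^ m * parts_ser (insert m S)"
  proof (rule fps_ext)
    fix n
    have "card (parts_in (insert m S) n) = card (parts_in S n) +
        card (if n < m then {} else add_mset m ` parts_in (insert m S) (n - m))"
      by (subst parts_in_insert[OF assms(1)], rule card_Un_disjoint)
         (use assms in \<open>auto simp: finite_parts_in, auto simp: parts_in_def\<close>)
    moreover have "card (add_mset m ` parts_in (insert m S) (n - m)) = card (parts_in (insert m S) (n - m))"
      by (intro card_image) (simp add: inj_on_def)
    ultimately show "parts_ser (insert m S) $ n = (parts_ser S + fps_X ^ m * parts_ser (insert m S)) $ n"
      by (simp add: parts_ser_def fps_X_power_mult_nth)
  qed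
  thus ?thesis by (simp add: algebra_simps)
qed

lemma parts_ser_prod:
  "finite S \<Longrightarrow> 0 \<notin> S \<Longrightarrow> parts_ser S * (\<Prod>m\<in>S. 1 - fps_X ^ m) = 1"
proof (induction S rule: finite_induct)
  case empty
  have "parts_in {} n = (if n = 0 then {{#}} else {})" for n
    by (auto simp: parts_in_def)
  then show ?case by (intro fps_ext) (auto simp: parts_ser_def)
next
  case (insert m S)
  have "parts_ser (insert m S) * (\<Prod>m\<in>insert m S. 1 - fps_X ^ m)
      = (parts_ser (insert m S) * (1 - fps_X ^ m)) * (\<Prod>m\<in>S. 1 - fps_X ^ m)"
    using insert by (simp add: mult.assoc)
  also have "\<dots> = 1"
    using insert by (subst parts_ser_insert) auto
  finally show ?case .
qed

section \<open>The residue classes excluded by \<open>E_count\<close>\<close>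

definition bad :: "nat \<Rightarrow> nat \<Rightarrow> nat \<Rightarrow> bool" where
  "bad r i x \<longleftrightarrow> x mod (2 * r + 1) \<in> {0, i, 2 * r + 1 - i}"

lemma bad_iff_cong:
  assumes "0 < i" "i \<le> r"
  shows "bad r i x \<longleftrightarrow> [int x = 0] (mod (2 * int r + 1)) \<or>
    [int x = int i] (mod (2 * int r + 1)) \<or> [int x = - int i] (mod (2 * int r + 1))"
proof -
  define c where "c = 2 * r + 1"
  have c: "2 * int r + 1 = int c" and ic: "i < c" "c - i < c" "0 < c" using assms by (simp_all add: c_def)
  have "int (c - i) = - int i + int c" using ic by simp
  hence "(- int i) mod int c = int (c - i) mod int c"
    by (simp only: mod_add_self2)
  hence "[int x = - int i] (mod int c) \<longleftrightarrow> [int x = int (c - i)] (mod int c)"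
    by (simp only: cong_def)
  moreover have "[int x = 0] (mod int c) \<longleftrightarrow> [x = 0] (mod c)"
    using cong_int_iff[of x 0 c] by simp
  ultimately show ?thesis
    unfolding c cong_int_iff by (simp add: bad_def cong_def ic del: One_nat_def flip: c_def)
qed

text \<open>No part of a partition of \<open>n\<close> exceeds \<open>n\<close>, so a finite set of
  parts suffices and \<open>parts_ser_prod\<close> becomes applicable.\<close>

lemma E_count_eq:
  assumes "0 < i" "i \<le> r" "n \<le> K"
  shows "int (E_count r i n) = parts_ser {x \<in> {1..K}. \<not> bad r i x} $ n"
proof -
  have "{xs. partition_of n xs \<and> (\<forall>x\<in>set xs. \<not> [int x = 0] (mod (2 * int r + 1)) \<and>
        \<not> [int x = int i] (mod (2 * int r + 1)) \<and>
        \<not> [int x = - int i] (mod (2 * int r + 1)))}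
     = {xs. partition_of n xs \<and> (\<lambda>M. \<forall>x\<in>#M. \<not> bad r i x) (mset xs)}"
    using assms by (auto simp: bad_iff_cong)
  moreover have "parts_in {x \<in> {1..K}. \<not> bad r i x} n =
      {M. 0 \<notin># M \<and> sum_mset M = n \<and> (\<lambda>M. \<forall>x\<in>#M. \<not> bad r i x) M}"
  proof -
    have "x \<le> K" if "x \<in># M" "sum_mset M = n" for x M
      using that member_le_sum_mset[of x M] assms(3) by simp
    moreover have "1 \<le> x" if "x \<in># M" "0 \<notin># M" for x and M :: "nat multiset"
      using that by (cases x) auto
    ultimately show ?thesis by (auto simp: parts_in_def)
  qed
  ultimately show ?thesis
    unfolding E_count_def parts_ser_def
    using card_partitions[of n "\<lambda>M. \<forall>x\<in>#M. \<not> bad r i x"] by (simp only: fps_nth_Abs_fps)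
qed

section \<open>The single sum satisfying Gordon's recurrence\<close>

text \<open>The number n(n-1)/2, without division.\<close>

definition tr :: "nat \<Rightarrow> nat" where
  "tr n = (\<Sum>k<n. k)"

lemma tr_0 [simp]: "tr 0 = 0" and tr_Suc [simp]: "tr (Suc n) = tr n + n"
  by (simp_all add: tr_def)

lemma tr_add: "tr (a + b) = tr a + tr b + a * b"
  by (induction b) auto

lemma stable_sum:
  assumes "\<And>n. eqm n (f n) 0"
  shows "stable (\<lambda>M. \<Sum>n\<le>M. f n)"
proof -
  have "eqm (Suc M) ((\<Sum>n\<le>M. f n) + f (Suc M)) ((\<Sum>n\<le>M. f n) + 0)" for M
    by (intro eqm_add assms) auto
  thus ?thesis by (simp add: stable_def)
qed

section \<open>The products (q^c; q^c)_n and Euler's infinite product\<close>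

definition poch :: "nat \<Rightarrow> nat \<Rightarrow> int fps" where
  "poch c n = (\<Prod>l<n. 1 - fps_X ^ (c * Suc l))"

lemma eqm_one_minus_X_power: "M \<le> k \<Longrightarrow> eqm M (1 - fps_X ^ k) 1"
  using eqm_diff[OF eqm_refl[of M 1] eqm_X_power_mult_0[of M k 1]] by simp

lemma poch_eqm_Suc:
  assumes "0 < c"
  shows "eqm (Suc n) (poch c (Suc n)) (poch c n)"
proof -
  have "Suc n \<le> c * Suc n" using assms mult_le_mono1[of 1 c "Suc n"] by simp
  hence "eqm (Suc n) (poch c n * (1 - fps_X ^ (c * Suc n))) (poch c n * 1)"
    by (intro eqm_mult eqm_one_minus_X_power) simp_all
  thus ?thesis by (simp add: poch_def)
qed

lemma stable_poch: "0 < c \<Longrightarrow> stable (poch c)"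
  using poch_eqm_Suc by (simp add: stable_def)

definition euler :: "int fps" where
  "euler = flim (poch 1)"

lemma euler_eqm: "eqm (Suc n) euler (poch 1 n)"
  unfolding euler_def by (rule flim_eqm) (simp add: stable_poch)

text \<open>The quotient (q)_(n+t) / (q)_n: what multiplication by \<open>euler\<close> makes of the
  denominator (q)_n (x q^(n+1))_\<infinity> in Andrews' series at x = q^t.\<close>

definition shifted_poch :: "nat \<Rightarrow> nat \<Rightarrow> int fps" where
  "shifted_poch n t = (\<Prod>j<t. 1 - fps_X ^ (n + Suc j))"

lemma shifted_poch_Suc: "shifted_poch n (Suc t) = shifted_poch n t * (1 - fps_X ^ (Suc t + n))"
  by (simp add: shifted_poch_def add_ac)

lemma shifted_poch_Suc': "shifted_poch n (Suc t) = (1 - fps_X ^ Suc n) * shifted_poch (Suc n) t"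
  by (simp add: shifted_poch_def prod.lessThan_Suc_shift del: prod.lessThan_Suc)

definition J_exp :: "nat \<Rightarrow> nat \<Rightarrow> nat \<Rightarrow> nat \<Rightarrow> nat" where
  "J_exp r i t n = r * n\<^sup>2 + (r - i) * n + r * t * n + tr n + n"

definition J_term :: "nat \<Rightarrow> nat \<Rightarrow> nat \<Rightarrow> nat \<Rightarrow> int fps" where
  "J_term r i t n = (-1) ^ n * fps_X ^ J_exp r i t n * (1 - fps_X ^ (i * (Suc t + 2 * n))) * shifted_poch n t"

text \<open>Up to the factor \<open>euler\<close> this is \<open>J\<^bsub>r,i\<^esub>(0; q\<^sup>t; q)\<close> in the notation of Andrews.\<close>

definition J_ser :: "nat \<Rightarrow> nat \<Rightarrow> nat \<Rightarrow> int fps" where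
  "J_ser r i t = flim (\<lambda>M. \<Sum>n\<le>M. J_term r i t n)"

lemma J_exp_0: "J_exp r i 0 j = r * (2 * tr j + j) + (r - i) * j + tr j + j"
proof -
  have "j\<^sup>2 = 2 * tr j + j" by (induction j) (auto simp: power2_eq_square)
  thus ?thesis by (simp add: J_exp_def)
qed

lemma J_term_eqm_0: "M \<le> J_exp r i t n \<Longrightarrow> eqm M (J_term r i t n) 0"
  using eqm_X_power_mult_0[of M "J_exp r i t n" "(-1) ^ n * (1 - fps_X ^ (i * (Suc t + 2 * n))) * shifted_poch n t"]
  by (simp add: J_term_def mult_ac)

lemma stable_J: "stable (\<lambda>M. \<Sum>n\<le>M. J_term r i t n)"
  by (rule stable_sum, rule J_term_eqm_0) (simp add: J_exp_def)

text \<open>A telescoping argument: the difference of the summands for \<open>Suc i\<close> and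
  \<open>i\<close> is \<open>U n + V n\<close>, while \<open>U (Suc n) + V n\<close> is a summand of
  the series at \<open>Suc t\<close>. Since \<open>U 0 = 0\<close>, only \<open>V M\<close> is left
  over.\<close>

lemma J_partial_sum_rec:
  fixes r i t :: nat
  assumes "i < r"
  defines "V \<equiv> \<lambda>n. (-1) ^ n * fps_X ^ (J_exp r i t n + i * (Suc t + 2 * n)) * shifted_poch n (Suc t)"
  shows "(\<Sum>n\<le>M. J_term r (Suc i) t n) =
    (\<Sum>n\<le>M. J_term r i t n) + fps_X ^ (Suc t * i) * (\<Sum>n<M. J_term r (r - i) (Suc t) n) + V M"
proof -
  obtain m where r: "r = Suc (i + m)" using assms less_imp_Suc_add by blast
  define U where "U = (\<lambda>n. (-1) ^ n * fps_X ^ J_exp r (Suc i) t n * (1 - fps_X ^ n) * shifted_poch n t)"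
  \<comment> \<open>The exponents for \<open>i\<close> and \<open>Suc i\<close> differ by
    \<open>n\<close>. The leading powers combine to 1 - q^n, giving \<open>U\<close>; the others to
    1 - q^(t+1+n), which extends \<open>shifted_poch n t\<close> and gives \<open>V\<close>.\<close>
  have diff: "J_term r (Suc i) t n = J_term r i t n + U n + V n" for n
  proof -
    have "J_exp r i t n = J_exp r (Suc i) t n + n" by (simp add: J_exp_def r algebra_simps)
    thus ?thesis
      by (simp add: J_term_def U_def V_def shifted_poch_Suc power_add mult_2_right algebra_simps)
  qed
  have UV: "U (Suc n) + V n = fps_X ^ (Suc t * i) * J_term r (r - i) (Suc t) n" for n
  proof -
    have "J_exp r (Suc i) t (Suc n) = Suc t * i + J_exp r (r - i) (Suc t) n + (r - i) * (Suc (Suc t) + 2 * n)"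
      by (simp add: J_exp_def r power2_eq_square algebra_simps)
    moreover have "J_exp r i t n + i * (Suc t + 2 * n) = Suc t * i + J_exp r (r - i) (Suc t) n"
      by (simp add: J_exp_def r power2_eq_square algebra_simps)
    moreover have "U (Suc n) = - ((-1) ^ n) * fps_X ^ J_exp r (Suc i) t (Suc n) * shifted_poch n (Suc t)"
      by (simp only: U_def shifted_poch_Suc' power_Suc) (simp add: mult_ac)
    ultimately have "U (Suc n) = - ((-1) ^ n) * (fps_X ^ (Suc t * i) * fps_X ^ J_exp r (r - i) (Suc t) n *
          fps_X ^ ((r - i) * (Suc (Suc t) + 2 * n))) * shifted_poch n (Suc t)"
      "V n = (-1) ^ n * (fps_X ^ (Suc t * i) * fps_X ^ J_exp r (r - i) (Suc t) n) * shifted_poch n (Suc t)"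
      by (simp_all only: V_def power_add[symmetric])
    moreover have "- e * (a * b * d) * p + e * (a * b) * p = a * (e * b * (1 - d) * p)" for a b d e p :: "int fps"
      by (simp add: algebra_simps)
    ultimately show ?thesis by (simp only: J_term_def)
  qed
  show ?thesis
  proof (induction M)
    case 0
    have "U 0 = 0" by (simp add: U_def)
    thus ?case using diff[of 0] by simp
  next
    case (Suc M)
    have "(\<Sum>n\<le>Suc M. J_term r (Suc i) t n) = (\<Sum>n\<le>M. J_term r i t n)
        + fps_X ^ (Suc t * i) * (\<Sum>n<M. J_term r (r - i) (Suc t) n) + V M
        + (J_term r i t (Suc M) + U (Suc M) + V (Suc M))"
      using Suc.IH diff[of "Suc M"] by simp
    also have "\<dots> = (\<Sum>n\<le>Suc M. J_term r i t n) + fps_X ^ (Suc t * i) * (\<Sum>n<M. J_term r (r - i) (Suc t) n)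
        + (U (Suc M) + V M) + V (Suc M)"
      by (simp add: algebra_simps)
    finally show ?case unfolding UV by (simp add: algebra_simps)
  qed
qed

lemma J_ser_rec:
  assumes "i < r"
  shows "J_ser r (Suc i) t = J_ser r i t + fps_X ^ (Suc t * i) * J_ser r (r - i) (Suc t)"
proof -
  define V :: "nat \<Rightarrow> int fps"
    where "V = (\<lambda>n. (-1) ^ n * fps_X ^ (J_exp r i t n + i * (Suc t + 2 * n)) * shifted_poch n (Suc t))"
  define F G :: "nat \<Rightarrow> int fps"
    where "F = (\<lambda>M. \<Sum>n\<le>M. J_term r i t n)" and "G = (\<lambda>M. \<Sum>n\<le>M. J_term r (r - i) (Suc t) n)"
  have V: "eqm M (V M) 0" for M
    using eqm_X_power_mult_0[of M "J_exp r i t M + i * (Suc t + 2 * M)" "(-1) ^ M * shifted_poch M (Suc t)"]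
    by (simp add: V_def mult_ac J_exp_def)
  show ?thesis
  proof (rule eqm_imp_eq)
    fix M
    have "eqm (Suc M) (J_ser r (Suc i) t) (\<Sum>n\<le>Suc M. J_term r (Suc i) t n)"
      unfolding J_ser_def using flim_eqm[OF stable_J] eqm_mono le_SucI by blast
    also have "(\<Sum>n\<le>Suc M. J_term r (Suc i) t n) = F (Suc M) + fps_X ^ (Suc t * i) * G M + V (Suc M)"
      unfolding J_partial_sum_rec[OF assms] V_def F_def G_def by (simp add: lessThan_Suc_atMost)
    also have "eqm (Suc M) \<dots> (J_ser r i t + fps_X ^ (Suc t * i) * J_ser r (r - i) (Suc t) + 0)"
      using V[of "Suc M"] flim_eqm[OF stable_J, of "Suc M" r i t] flim_eqm[OF stable_J, of M r "r - i" "Suc t"]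
      unfolding J_ser_def F_def G_def
      by (intro eqm_add eqm_mult eqm_refl) (auto intro: eqm_sym eqm_mono)
    finally show "eqm M (J_ser r (Suc i) t) (J_ser r i t + fps_X ^ (Suc t * i) * J_ser r (r - i) (Suc t))"
      by (simp add: eqm_def)
  qed
qed

lemma J_ser_0: "J_ser r 0 t = 0"
  by (rule fps_ext) (simp add: J_ser_def flim_def J_term_def)

text \<open>Modulo q^(t+1) only the summand \<open>n = 0\<close> survives. It reduces to (q)_t,
  which agrees with \<open>euler\<close> to that order.\<close>

lemma J_ser_eqm_euler:
  assumes "0 < i" "i \<le> r"
  shows "eqm (Suc t) (J_ser r i t) euler"
proof -
  have "eqm (Suc t) (\<Sum>n\<le>M. J_term r i t n) (\<Sum>n\<le>M. if n = 0 then euler else 0)" for M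
  proof (rule eqm_sum)
    fix n
    show "eqm (Suc t) (J_term r i t n) (if n = 0 then euler else 0)"
    proof (cases n)
      case 0
      have "Suc t \<le> i * Suc t" using assms mult_le_mono1[of 1 i "Suc t"] by simp
      hence "eqm (Suc t) ((1 - fps_X ^ (i * Suc t)) * poch 1 t) (1 * euler)"
        by (intro eqm_mult eqm_one_minus_X_power eqm_sym[OF euler_eqm])
      then show ?thesis using 0 by (simp add: J_term_def J_exp_def shifted_poch_def poch_def)
    next
      case (Suc k)
      have le: "r * (n * 1) \<le> r * (n * n)" using Suc by (intro mult_le_mono2) simp
      have "1 * Suc t * 1 \<le> r * Suc t * n" using assms Suc by (intro mult_mono) auto
      also have "\<dots> = r * t * n + r * (n * 1)" by (simp add: algebra_simps)
      also have "\<dots> \<le> J_exp r i t n"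
        unfolding J_exp_def power2_eq_square using le by linarith
      finally show ?thesis using Suc J_term_eqm_0 by simp
    qed
  qed
  hence "eqm (Suc t) (\<Sum>n\<le>M. J_term r i t n) euler" for M by simp
  thus ?thesis unfolding J_ser_def by (rule eqm_flim)
qed

text \<open>The factor \<open>euler\<close> gives both sides the same leading terms. Their
  difference feeds itself, so \<open>recurrence_unique\<close> applies with equal families.\<close>

lemma euler_T_ser:
  assumes "0 < r" "i \<le> r"
  shows "euler * T_ser r i t = J_ser r i t"
proof -
  have *: "eqm (Suc t) (euler * T_ser r i t - J_ser r i t) 0" if "i \<le> r" for i t
  proof (cases "i = 0")
    case False
    have "eqm (Suc t) (euler * T_ser r i t - J_ser r i t) (euler * 1 - euler)"
      using False that assms by (intro eqm_diff eqm_mult T_ser_eqm_1 J_ser_eqm_euler) auto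
    thus ?thesis by simp
  qed (simp add: T_ser_0 J_ser_0)
  have "euler * T_ser r i t - J_ser r i t = 0"
    by (rule recurrence_unique[where d = "\<lambda>i t. euler * T_ser r i t - J_ser r i t" 
        and d' = "\<lambda>i t. euler * T_ser r i t - J_ser r i t" and r = r])
       (use assms * in \<open>simp_all add: T_ser_0 J_ser_0 T_ser_rec J_ser_rec algebra_simps\<close>)
  thus ?thesis by simp
qed

section \<open>The product side\<close>

text \<open>Kept homogeneous in \<open>x\<close> and \<open>y\<close>, so that the triple product
  can be obtained without negative powers. The induction step is the second q-Pascal rule.\<close>

lemma q_binomial_theorem:
  fixes q x y :: "'a::comm_ring_1"
  shows "(\<Prod>k<N. x + y * q ^ k) = (\<Sum>m\<le>N. q ^ tr m * qbin q N m * x ^ (N - m) * y ^ m)"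
proof (induction N)
  case (Suc N)
  define f where "f = (\<lambda>m. q ^ tr m * qbin q N m * x ^ (Suc N - m) * y ^ m)"
  define g where "g = (\<lambda>m. q ^ (tr m + N) * qbin q N m * x ^ (N - m) * y ^ Suc m)"
  have "(\<Prod>k<Suc N. x + y * q ^ k) = (\<Sum>m\<le>N. q ^ tr m * qbin q N m * x ^ (N - m) * y ^ m) * (x + y * q ^ N)"
    by (simp add: Suc.IH)
  also have "\<dots> = (\<Sum>m\<le>N. f m) + (\<Sum>m\<le>N. g m)"
    unfolding sum_distrib_right sum.distrib[symmetric] f_def g_def
    by (rule sum.cong) (simp_all add: Suc_diff_le power_add algebra_simps)
  also have "(\<Sum>m\<le>N. f m) = (\<Sum>m\<le>Suc N. f m)"
    by (simp add: f_def qbin_eq_0)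
  also have "\<dots> = f 0 + (\<Sum>m\<le>N. f (Suc m))"
    by (rule sum.atMost_Suc_shift)
  also have "f 0 + (\<Sum>m\<le>N. f (Suc m)) + (\<Sum>m\<le>N. g m) = f 0 + (\<Sum>m\<le>N. f (Suc m) + g m)"
    by (simp add: sum.distrib)
  also have "(\<Sum>m\<le>N. f (Suc m) + g m) = (\<Sum>m\<le>N. q ^ tr (Suc m) * qbin q (Suc N) (Suc m) * x ^ (Suc N - Suc m) * y ^ Suc m)"
  proof (rule sum.cong)
    fix m assume "m \<in> {..N}"
    then obtain l where N: "N = m + l" by (auto simp: le_iff_add)
    show "f (Suc m) + g m = q ^ tr (Suc m) * qbin q (Suc N) (Suc m) * x ^ (Suc N - Suc m) * y ^ Suc m"
      unfolding f_def g_def by (subst qbin_Suc_Suc) (simp_all add: N power_add algebra_simps)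
  qed simp
  also have "f 0 + \<dots> = (\<Sum>m\<le>Suc N. q ^ tr m * qbin q (Suc N) m * x ^ (Suc N - m) * y ^ m)"
    unfolding sum.atMost_Suc_shift[of _ N] by (simp add: f_def)
  finally show ?case .
qed simp

text \<open>The product formula for Gaussian binomials, cleared of denominators; each step of the
  induction is \<open>qbin_absorb\<close>.\<close>

lemma qbin_mult_poch:
  "qbin (fps_X ^ c) (k + m) k * poch c k = (\<Prod>l<k. 1 - fps_X ^ (c * (m + Suc l)))"
proof (induction k)
  case (Suc k)
  let ?q = "fps_X ^ c :: int fps"
  have "qbin ?q (Suc k + m) (Suc k) * poch c (Suc k) = (1 - ?q ^ Suc k) * qbin ?q (Suc (k + m)) (Suc k) * poch c k"
    by (simp only: poch_def prod.lessThan_Suc power_mult add_Suc mult_ac)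
  also have "\<dots> = (1 - ?q ^ Suc (k + m)) * (qbin ?q (k + m) k * poch c k)"
    unfolding qbin_absorb by (simp add: mult.assoc)
  also have "\<dots> = (\<Prod>l<Suc k. 1 - fps_X ^ (c * (m + Suc l)))"
    unfolding Suc.IH prod.lessThan_Suc power_mult[symmetric] by (simp only: add_Suc_right add.commute mult.commute)
  finally show ?case .
qed (simp add: poch_def)

lemma eqm_prod_1: "(\<And>x. x \<in> A \<Longrightarrow> eqm M (f x) 1) \<Longrightarrow> eqm M (prod f A) 1"
proof (induction A rule: infinite_finite_induct)
  case (insert x F)
  thus ?case using eqm_mult[of M "f x" 1 "prod f F" 1] by simp
qed simp_all

text \<open>A quantitative form of the limit 1 / (q^c; q^c)_\<infinity> of the Gaussian binomial
  when both \<open>k\<close> and \<open>m\<close> grow.\<close>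

lemma qbin_poch_eqm_1:
  assumes "0 < c" "d \<le> k" "d \<le> m" "d \<le> n"
  shows "eqm (Suc d) (qbin (fps_X ^ c) (k + m) k * poch c n) 1"
proof -
  have "eqm (Suc d) (poch c n) (poch c d)" "eqm (Suc d) (poch c k) (poch c d)"
    using assms by (auto intro!: stable_eqm stable_poch)
  hence "eqm (Suc d) (poch c n) (poch c k)" using eqm_sym eqm_trans by blast
  hence "eqm (Suc d) (qbin (fps_X ^ c) (k + m) k * poch c n) (qbin (fps_X ^ c) (k + m) k * poch c k)"
    by (intro eqm_mult eqm_refl)
  also have "eqm (Suc d) \<dots> 1"
    unfolding qbin_mult_poch
  proof (intro eqm_prod_1 eqm_one_minus_X_power)
    fix l
    have "1 * Suc d \<le> c * (m + Suc l)" using assms by (intro mult_mono) auto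
    thus "Suc d \<le> c * (m + Suc l)" by simp
  qed
  finally show ?thesis .
qed

text \<open>The finite Jacobi triple product, from the \<open>q\<close>-binomial theorem with
  \<open>x = Q\<^sup>n\<close> and \<open>y = -u\<close>, where \<open>Q = uv\<close>: for \<open>k < n\<close> the factor \<open>x + y Q\<^sup>k\<close> is
  \<open>-u Q\<^sup>k (1 - v Q\<^bsup>n-1-k\<^esup>)\<close>, for \<open>k = n + l\<close> it is \<open>Q\<^sup>n (1 - u Q\<^sup>l)\<close>.\<close>

lemma finite_triple_product:
  fixes r i n :: nat
  assumes "0 < i" "i \<le> r"
  defines "c \<equiv> 2 * r + 1"
  shows "(\<Prod>k<n. (1 - fps_X ^ (c * k + (c - i))) * (1 - fps_X ^ (c * k + i))) =
    (\<Sum>j\<le>n. (-1) ^ j * fps_X ^ J_exp r i 0 j * qbin (fps_X ^ c) (2 * n) (n + j)) -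
    (\<Sum>j<n. (-1) ^ j * fps_X ^ (J_exp r i 0 j + i * (1 + 2 * j)) * qbin (fps_X ^ c) (2 * n) (n - Suc j) :: int fps)"
    (is "?P = ?R")
proof -
  let ?X = "fps_X :: int fps"
  define Q where "Q = ?X ^ c"
  define u where "u = ?X ^ (c - i)"
  define v where "v = ?X ^ i"
  define s where "s = r - i"
  have r: "r = i + s" using assms by (simp add: s_def)
  have c: "c = i + (i + 2 * s + 1)" "c - i = i + 2 * s + 1" by (simp_all add: c_def r)
  have Q: "Q = u * v" by (simp add: Q_def u_def v_def c flip: power_add)
  \<comment> \<open>The exponent in the middle summand \<open>f n\<close>. Taking it and the sign
    (-1)^n out of every summand leaves the exponents of Andrews' series.\<close>
  define K where "K = c * n * n + c * tr n + (c - i) * n"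
  define f where "f = (\<lambda>m. Q ^ tr m * qbin Q (2 * n) m * (Q ^ n) ^ (2 * n - m) * (- u) ^ m)"
  have prod_split: "(\<Prod>k<n + m. g k) = (\<Prod>k<n. g k) * (\<Prod>k<m. g (n + k))" for g :: "nat \<Rightarrow> int fps" and m
    by (induction m) (simp_all add: mult_ac)
  have sum_split: "(\<Sum>k\<le>n + m. g k) = (\<Sum>k<n. g k) + (\<Sum>k\<le>m. g (n + k))" for g :: "nat \<Rightarrow> int fps" and m
    by (induction m) (simp_all add: add_ac flip: lessThan_Suc_atMost)
  have "(\<Prod>k<n. Q ^ n + (- u) * Q ^ k) = (\<Prod>k<n. (- u) * Q ^ k * (1 - v * Q ^ (n - Suc k)))"
  proof (rule prod.cong)
    fix k assume "k \<in> {..<n}"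
    then obtain l where "n = k + Suc l" using less_imp_Suc_add by auto
    thus "Q ^ n + (- u) * Q ^ k = (- u) * Q ^ k * (1 - v * Q ^ (n - Suc k))"
      by (simp add: power_add algebra_simps) (simp add: Q mult_ac)
  qed simp
  also have "\<dots> = (- u) ^ n * Q ^ tr n * (\<Prod>k<n. 1 - v * Q ^ k)"
    unfolding prod.distrib prod.nat_diff_reindex[of "\<lambda>k. 1 - v * Q ^ k"] tr_def power_sum by simp
  finally have 1: "(\<Prod>k<n. Q ^ n + (- u) * Q ^ k) = (- u) ^ n * Q ^ tr n * (\<Prod>k<n. 1 - v * Q ^ k)" .
  have "(\<Prod>k<n. Q ^ n + (- u) * Q ^ (n + k)) = (\<Prod>k<n. Q ^ n * (1 - u * Q ^ k))"
    by (rule prod.cong) (simp_all add: power_add algebra_simps)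
  also have "\<dots> = (Q ^ n) ^ n * (\<Prod>k<n. 1 - u * Q ^ k)"
    by (simp add: prod.distrib)
  finally have 2: "(\<Prod>k<n. Q ^ n + (- u) * Q ^ (n + k)) = (Q ^ n) ^ n * (\<Prod>k<n. 1 - u * Q ^ k)" .
  have pow: "Q ^ a = ?X ^ (c * a)" "(- u) ^ a = (-1) ^ a * ?X ^ ((c - i) * a)" for a
    by (simp_all add: Q_def u_def power_mult power_minus[of "?X ^ _"])
  have "?P = (\<Prod>k<n. 1 - u * Q ^ k) * (\<Prod>k<n. 1 - v * Q ^ k)"
    unfolding prod.distrib[symmetric] pow u_def v_def by (simp add: add_ac flip: power_add)
  hence "(-1) ^ n * ?X ^ K * ?P = (\<Prod>k<n + n. Q ^ n + (- u) * Q ^ k)"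
    unfolding prod_split 1 2 by (simp add: pow K_def power_add mult_ac flip: power_mult)
  also have "\<dots> = (\<Sum>m\<le>n + n. f m)"
    unfolding q_binomial_theorem f_def mult_2 ..
  \<comment> \<open>The sum is folded at \<open>m = n\<close>: the upper and lower halves become the
    two terms that the factor 1 - q^(i(1+2j)) of \<open>J_term r i 0 j\<close> produces.\<close>
  also have "\<dots> = (\<Sum>j<n. f (n - Suc j)) + (\<Sum>j\<le>n. f (n + j))"
    unfolding sum_split by (simp add: sum.nat_diff_reindex)
  also have "(\<Sum>j\<le>n. f (n + j)) =
      (\<Sum>j\<le>n. (-1) ^ n * ?X ^ K * ((-1) ^ j * ?X ^ J_exp r i 0 j * qbin Q (2 * n) (n + j)))"
  proof (rule sum.cong)
    fix j assume "j \<in> {..n}"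
    then obtain l where n: "n = j + l" by (auto simp: le_iff_add)
    have "c * tr (n + j) + c * n * l + (c - i) * (n + j) = K + J_exp r i 0 j"
      unfolding K_def J_exp_0 tr_add[of n j] c r by (simp add: n algebra_simps)
    hence "?X ^ (c * tr (n + j)) * ?X ^ (c * n * l) * ?X ^ ((c - i) * (n + j)) = ?X ^ K * ?X ^ J_exp r i 0 j"
      by (simp only: power_add[symmetric])
    moreover have "2 * n - (n + j) = l" by (simp add: n)
    ultimately show "f (n + j) = (-1) ^ n * ?X ^ K * ((-1) ^ j * ?X ^ J_exp r i 0 j * qbin Q (2 * n) (n + j))"
      by (simp add: f_def pow power_add[of "-1"] mult_ac flip: power_mult)
  qed simp
  also have "(\<Sum>j<n. f (n - Suc j)) =
      (\<Sum>j<n. (-1) ^ n * ?X ^ K * - ((-1) ^ j * ?X ^ (J_exp r i 0 j + i * (1 + 2 * j)) * qbin Q (2 * n) (n - Suc j)))"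
  proof (rule sum.cong)
    fix j assume "j \<in> {..<n}"
    then obtain l where n: "n = Suc j + l" using less_imp_Suc_add by auto
    \<comment> \<open>Relates the square in \<open>J_exp\<close> to the triangular numbers from
      \<open>tr_add\<close>, which the exponent identity needs.\<close>
    have tj: "int j * int j = 2 * int (tr j) + int j" by (induction j) (auto simp: algebra_simps)
    have "int (c * tr l + c * n * (n + Suc j) + (c - i) * l) = int (K + (J_exp r i 0 j + i * (1 + 2 * j)))"
      using tj unfolding K_def J_exp_def c r tr_add n power2_eq_square
      by simp algebra
    hence "c * tr l + c * n * (n + Suc j) + (c - i) * l = K + (J_exp r i 0 j + i * (1 + 2 * j))"
      by (simp only: of_nat_eq_iff)
    hence eq: "?X ^ (c * tr l) * ?X ^ (c * n * (n + Suc j)) * ?X ^ ((c - i) * l) = ?X ^ K * ?X ^ (J_exp r i 0 j + i * (1 + 2 * j))"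
      by (simp only: power_add[symmetric])
    have nj: "n - Suc j = l" and nl: "2 * n - l = n + Suc j" by (simp_all add: n)
    have sgn: "(-1 :: int fps) ^ l = (-1) ^ n * - ((-1) ^ j)" by (simp add: n power_add)
    have "f l = (-1) ^ l * (?X ^ (c * tr l) * ?X ^ (c * n * (n + Suc j)) * ?X ^ ((c - i) * l)) * qbin Q (2 * n) l"
      unfolding f_def pow nl power_mult[symmetric] by (simp only: mult_ac)
    also have "\<dots> = (-1) ^ n * ?X ^ K * - ((-1) ^ j * ?X ^ (J_exp r i 0 j + i * (1 + 2 * j)) * qbin Q (2 * n) l)"
      unfolding eq sgn by (simp only: mult_ac mult_minus_left mult_minus_right)
    finally show "f (n - Suc j) = (-1) ^ n * ?X ^ K *
        - ((-1) ^ j * ?X ^ (J_exp r i 0 j + i * (1 + 2 * j)) * qbin Q (2 * n) (n - Suc j))"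
      unfolding nj .
  qed simp
  finally have "(-1) ^ n * ?X ^ K * ?P = (-1) ^ n * ?X ^ K * ?R"
    unfolding sum_distrib_left[symmetric] sum_negf Q_def
    by (simp only: distrib_left mult_minus_right add.commute diff_conv_add_uminus)
  moreover have "(-1) ^ n * ?X ^ K \<noteq> 0" by simp
  ultimately show ?thesis using mult_left_cancel by blast
qed

text \<open>After multiplication by \<open>poch c n\<close> each Gaussian binomial in the finite
  triple product is close to 1. For \<open>j\<close> near \<open>n\<close> it is so only to an order
  of about \<open>n - j\<close>, but the power of q beside it has degree at least \<open>j\<close>
  and makes up the loss.\<close>

lemma J_ser_eqm_product:
  assumes "0 < i" "i \<le> r"
  defines "c \<equiv> 2 * r + 1"
  shows "eqm n (J_ser r i 0)
    (poch c n * (\<Prod>k<n. (1 - fps_X ^ (c * k + (c - i))) * (1 - fps_X ^ (c * k + i))))"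
proof -
  let ?X = "fps_X :: int fps"
  define e e' where "e = J_exp r i 0" and "e' = (\<lambda>j. J_exp r i 0 j + i * (1 + 2 * j))"
  have e: "j \<le> e j" for j by (simp add: e_def J_exp_def)
  have e': "Suc j \<le> e' j" for j
  proof -
    have "Suc j \<le> 1 * (1 + 2 * j)" by simp
    also have "\<dots> \<le> i * (1 + 2 * j)" using assms(1) by (intro mult_le_mono1) simp
    also have "\<dots> \<le> e' j" unfolding e'_def by (rule le_add2)
    finally show ?thesis .
  qed
  define S where "S = (\<Sum>j\<le>n. (-1) ^ j * ?X ^ e j)"
  define S' where "S' = (\<Sum>j<n. (-1) ^ j * ?X ^ e' j)"
  have qb: "eqm n (poch c n * ((-1) ^ j * ?X ^ k * qbin (?X ^ c) (2 * n) l)) ((-1) ^ j * ?X ^ k)"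
    if "d \<le> l" "d + l \<le> 2 * n" "d \<le> n" "n \<le> Suc d + k" "l \<le> 2 * n" for d j k l
  proof -
    have "eqm (Suc d) (qbin (?X ^ c) (l + (2 * n - l)) l * poch c n) 1"
      using that by (intro qbin_poch_eqm_1) (auto simp: c_def)
    hence "eqm (Suc d + k) (?X ^ k * (qbin (?X ^ c) (2 * n) l * poch c n)) (?X ^ k * 1)"
      using that by (intro eqm_X_power_mult) simp
    hence "eqm n ((-1) ^ j * (?X ^ k * (qbin (?X ^ c) (2 * n) l * poch c n))) ((-1) ^ j * (?X ^ k * 1))"
      by (rule eqm_mult[OF eqm_refl eqm_mono[OF _ that(4)]])
    thus ?thesis by (simp add: mult_ac)
  qed
  have "eqm n (poch c n * (\<Prod>k<n. (1 - ?X ^ (c * k + (c - i))) * (1 - ?X ^ (c * k + i)))) (S - S')"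
    unfolding finite_triple_product[OF assms(1,2), folded c_def]
    unfolding right_diff_distrib sum_distrib_left S_def S'_def
  proof (intro eqm_diff eqm_sum)
    fix j assume "j \<in> {..n}"
    thus "eqm n (poch c n * ((- 1) ^ j * ?X ^ J_exp r i 0 j * qbin (?X ^ c) (2 * n) (n + j))) ((- 1) ^ j * ?X ^ e j)"
      unfolding e_def[symmetric] using e[of j] by (intro qb[of "n - j"]) auto
  next
    fix j assume "j \<in> {..<n}"
    thus "eqm n (poch c n * ((- 1) ^ j * ?X ^ (J_exp r i 0 j + i * (1 + 2 * j)) * qbin (?X ^ c) (2 * n) (n - Suc j))) ((- 1) ^ j * ?X ^ e' j)"
      using e'[of j] unfolding e'_def by (intro qb[of "n - Suc j"]) auto
  qed
  moreover have "eqm n (J_ser r i 0) (S - S')"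
  proof -
    have "J_term r i 0 j = (-1) ^ j * ?X ^ e j - (-1) ^ j * ?X ^ e' j" for j
      by (simp add: J_term_def shifted_poch_def e_def e'_def power_add algebra_simps)
    \<comment> \<open>\<open>S'\<close> stops before \<open>n\<close>, so the partial sum has one
      extra term, of degree above \<open>n\<close>.\<close>
    hence sum: "(\<Sum>j\<le>n. J_term r i 0 j) = S - (S' + ?X ^ e' n * (-1) ^ n)"
      by (simp add: S_def S'_def sum_subtractf mult_ac flip: lessThan_Suc_atMost)
    have "eqm n (J_ser r i 0) (\<Sum>j\<le>n. J_term r i 0 j)"
      unfolding J_ser_def using flim_eqm[OF stable_J] eqm_mono le_SucI by blast
    also have "eqm n (\<Sum>j\<le>n. J_term r i 0 j) (S - (S' + 0))"
      unfolding sum using e'[of n] by (intro eqm_diff eqm_add eqm_refl eqm_X_power_mult_0) simp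
    finally show ?thesis by simp
  qed
  ultimately show ?thesis using eqm_sym eqm_trans by blast
qed

text \<open>Every period of length \<open>c\<close> contributes exactly three bad numbers, one in
  each of the classes 0, i and -i; these classes are distinct because 0 < i <= r.\<close>

lemma prod_bad:
  assumes "0 < i" "i \<le> r"
  defines "c \<equiv> 2 * r + 1"
  shows "(\<Prod>m\<in>{x \<in> {1..c * n}. bad r i x}. 1 - fps_X ^ m) =
    poch c n * (\<Prod>k<n. (1 - fps_X ^ (c * k + (c - i))) * (1 - fps_X ^ (c * k + i)) :: int fps)"
proof (induction n)
  case (Suc n)
  have ic: "i < c" "c - i < c" "i \<noteq> c - i" "0 < c - i" using assms by (auto simp: c_def)
  let ?B = "\<lambda>n. {x \<in> {1..c * n}. bad r i x}"
  let ?N = "{c * Suc n, c * n + (c - i), c * n + i}"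
  have bad_off: "bad r i (c * n + d) \<longleftrightarrow> d \<in> {c, i, c - i}" if "0 < d" "d \<le> c" for d
    using that ic unfolding bad_def c_def[symmetric] by (cases "d = c") auto
  have B: "?B (Suc n) = ?B n \<union> ?N"
  proof (intro equalityI subsetI)
    fix x assume x: "x \<in> ?B (Suc n)"
    show "x \<in> ?B n \<union> ?N"
    proof (cases "x \<le> c * n")
      case False
      then obtain d where d: "x = c * n + d" "0 < d"
        by (metis less_imp_add_positive not_le)
      have "d \<le> c" using x d by simp
      thus ?thesis using bad_off[of d] x d by auto
    qed (use x in auto)
  next
    fix x assume "x \<in> ?B n \<union> ?N"
    thus "x \<in> ?B (Suc n)"
      using bad_off[of c] bad_off[of i] bad_off[of "c - i"] ic assms(1) by (auto simp: add_ac)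
  qed
  have "?B n \<inter> ?N = {}" using ic assms(1) by auto
  hence "(\<Prod>m\<in>?B (Suc n). 1 - fps_X ^ m) = (\<Prod>m\<in>?B n. 1 - fps_X ^ m) * (\<Prod>m\<in>?N. 1 - fps_X ^ m :: int fps)"
    unfolding B by (intro prod.union_disjoint) auto
  also have "(\<Prod>m\<in>?N. 1 - fps_X ^ m :: int fps) =
      (1 - fps_X ^ (c * Suc n)) * ((1 - fps_X ^ (c * n + (c - i))) * (1 - fps_X ^ (c * n + i)))"
    using ic by simp
  finally show ?case unfolding Suc.IH by (simp add: poch_def mult_ac)
qed (simp add: poch_def)

lemma prod_one_minus_X_power_nth_0:
  "finite A \<Longrightarrow> 0 \<notin> A \<Longrightarrow> (\<Prod>m\<in>A. 1 - fps_X ^ m :: int fps) $ 0 = 1"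
  by (induction A rule: finite_induct) auto

text \<open>To the required order \<open>euler\<close> is the product over good and bad parts, while
  \<open>euler * T_ser r i 0\<close> is the product over bad ones. Cancelling leaves T times the
  good product equal to 1, just as for \<open>parts_ser good\<close>.\<close>

lemma T_count_eq_E_count:
  assumes "0 < i" "i \<le> r"
  shows "T_count r i n = E_count r i n"
proof -
  \<comment> \<open>\<open>K\<close> is a whole number of periods, as \<open>prod_bad\<close> needs;
    precision \<open>N\<close> covers the coefficient at \<open>n\<close>.\<close>
  define c N K where "c = 2 * r + 1" and "N = Suc n" and "K = c * N"
  define good where "good = {x \<in> {1..K}. \<not> bad r i x}"
  define PG PB where "PG = (\<Prod>m\<in>good. 1 - fps_X ^ m :: int fps)"
    and "PB = (\<Prod>m\<in>{x \<in> {1..K}. bad r i x}. 1 - fps_X ^ m :: int fps)"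
  have "N \<le> Suc K" by (simp add: K_def c_def)
  have nth0: "PG $ 0 = 1" "PB $ 0 = 1"
    unfolding PG_def PB_def good_def by (rule prod_one_minus_X_power_nth_0; simp)+
  have "poch 1 K = (\<Prod>m\<in>{1..K}. 1 - fps_X ^ m)"
    unfolding poch_def by (rule prod.reindex_bij_witness[of _ "\<lambda>m. m - 1" Suc]) auto
  also have "\<dots> = PG * PB"
    unfolding PG_def PB_def good_def
    by (subst prod.union_disjoint[symmetric]) (auto intro!: prod.cong)
  finally have poch: "poch 1 K = PG * PB" .
  have "eqm N (T_ser r i 0 * PG * PB) (euler * T_ser r i 0)"
  proof -
    have "eqm N (poch 1 K * T_ser r i 0) (euler * T_ser r i 0)"
      using euler_eqm[of K] \<open>N \<le> Suc K\<close> by (intro eqm_mult eqm_refl) (auto intro: eqm_sym eqm_mono)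
    thus ?thesis by (simp only: poch mult_ac)
  qed
  also have "euler * T_ser r i 0 = J_ser r i 0"
    using assms by (intro euler_T_ser) auto
  also have "eqm N (J_ser r i 0) (1 * PB)"
    using J_ser_eqm_product[OF assms, of N] prod_bad[OF assms, of N]
    unfolding PB_def K_def c_def by simp
  finally have "eqm N (T_ser r i 0 * PG) 1"
    using nth0(2) eqm_cancel by blast
  moreover have "parts_ser good * PG = 1"
    unfolding PG_def by (rule parts_ser_prod) (auto simp: good_def)
  ultimately have "eqm N (T_ser r i 0) (parts_ser good)"
    using nth0(1) eqm_cancel by metis
  hence "T_ser r i 0 $ n = parts_ser good $ n"
    by (simp add: eqm_def N_def)
  moreover have "int (T_count r i n) = T_ser r i 0 $ n"
    using assms by (intro T_count_eq) auto
  moreover have "int (E_count r i n) = parts_ser good $ n"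
    unfolding good_def by (rule E_count_eq[OF assms]) (simp add: K_def N_def c_def)
  ultimately show ?thesis by simp
qed

section \<open>Block coverings of partitions\<close>

text \<open>Cutting from the largest part on, an entry \<open>0\<close> stands for a square block and an entry \<open>1\<close> for a
  rectangular one. Any segment of an admissible block is admissible, so greedy cutting from either end
  decides whether a cutting exists.\<close>

fun cov :: "nat list \<Rightarrow> nat list \<Rightarrow> bool" where
  "cov [] xs \<longleftrightarrow> xs = []"
| "cov (e # es) xs \<longleftrightarrow> (\<exists>d\<le>length xs. (0 < d \<longrightarrow> d + e \<le> xs ! (d - 1)) \<and> cov es (drop d xs))"

lemma cov_Nil [simp]: "cov es []"
  by (induction es) auto

lemma cov_drop: "cov es xs \<Longrightarrow> cov es (drop k xs)"
proof (induction es arbitrary: xs k)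
  case (Cons e es)
  then obtain d where d: "d \<le> length xs" "0 < d \<longrightarrow> d + e \<le> xs ! (d - 1)" "cov es (drop d xs)"
    by auto
  show ?case
  proof (cases "k < d")
    case True
    hence "drop (d - k) (drop k xs) = drop d xs" "drop k xs ! (d - k - 1) = xs ! (d - 1)" "d - k + e \<le> d + e"
      using d(1) by auto
    thus ?thesis using d True by (auto intro!: exI[of _ "d - k"])
  next
    case False
    hence "drop k xs = drop (k - d) (drop d xs)" by simp
    hence "cov es (drop k xs)" using Cons.IH[OF d(3)] by metis
    thus ?thesis by (auto intro!: exI[of _ 0])
  qed
qed simp

text \<open>Shortening a block at its small end may change its smallest part, but by sortedness
  never to a smaller one; the block stays admissible.\<close>

lemma cov_take: "sorted_wrt (\<ge>) xs \<Longrightarrow> cov es xs \<Longrightarrow> cov es (take k xs)"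
proof (induction es arbitrary: xs k)
  case (Cons e es)
  then obtain d where d: "d \<le> length xs" "0 < d \<longrightarrow> d + e \<le> xs ! (d - 1)" "cov es (drop d xs)"
    by auto
  show ?case
  proof (cases "k < d")
    case True
    have "k + e \<le> xs ! (k - 1)" if "0 < k"
    proof -
      have "xs ! (d - 1) \<le> xs ! (k - 1)"
        using Cons.prems(1) True that d(1) by (intro nth_mono_desc) auto
      thus ?thesis using d(2) True by auto
    qed
    thus ?thesis using True d(1) by (auto intro!: exI[of _ k])
  next
    case False
    have "cov es (take (k - d) (drop d xs))"
      by (intro Cons.IH d(3)) (simp add: Cons.prems(1) sorted_wrt_drop)
    hence "cov es (drop d (take k xs))" by (simp add: drop_take)
    thus ?thesis using False d by (auto intro!: exI[of _ d])
  qed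
qed simp

text \<open>The recursion read from the small end: \<open>k\<close> is the number of parts in front
  of the last block.\<close>

lemma cov_snoc:
  "cov (es @ [e]) xs \<longleftrightarrow>
    (\<exists>k\<le>length xs. (k < length xs \<longrightarrow> length xs - k + e \<le> last xs) \<and> cov es (take k xs))"
proof (induction es arbitrary: xs)
  case Nil
  show ?case
    by (cases "xs = []") (auto simp: last_conv_nth)
next
  case (Cons e' es)
  show ?case
  proof
    assume "cov ((e' # es) @ [e]) xs"
    then obtain d k where d: "d \<le> length xs" "0 < d \<longrightarrow> d + e' \<le> xs ! (d - 1)"
      and k: "k \<le> length xs - d" "k < length xs - d \<longrightarrow> length xs - d - k + e \<le> last (drop d xs)"
        "cov es (take k (drop d xs))"
      by (auto simp: Cons.IH)
    have "cov es (drop d (take (d + k) xs))" using k(3) by (simp add: drop_take)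
    hence "cov (e' # es) (take (d + k) xs)"
      using d k(1) by (auto intro!: exI[of _ d])
    thus "\<exists>k\<le>length xs. (k < length xs \<longrightarrow> length xs - k + e \<le> last xs) \<and> cov (e' # es) (take k xs)"
      using d(1) k(1,2) by (intro exI[of _ "d + k"]) (auto simp: last_drop)
  next
    assume "\<exists>k\<le>length xs. (k < length xs \<longrightarrow> length xs - k + e \<le> last xs) \<and> cov (e' # es) (take k xs)"
    then obtain k where k: "k \<le> length xs" "k < length xs \<longrightarrow> length xs - k + e \<le> last xs"
      and "cov (e' # es) (take k xs)" by blast
    then obtain d where "d \<le> length (take k xs)" "0 < d \<longrightarrow> d + e' \<le> take k xs ! (d - 1)"
      and d: "cov es (drop d (take k xs))"
      unfolding cov.simps by blast
    hence d': "d \<le> k" "0 < d \<longrightarrow> d + e' \<le> xs ! (d - 1)" by auto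
    have "cov (es @ [e]) (drop d xs)"
      unfolding Cons.IH using k d d' by (intro exI[of _ "k - d"]) (auto simp: drop_take last_drop)
    thus "cov ((e' # es) @ [e]) xs"
      using d d' k by (auto intro!: exI[of _ d])
  qed
qed

text \<open>The smallest part limits the last block to \<open>last xs - e\<close> parts. Taking all
  of them leaves a prefix of what any other choice leaves, so \<open>cov_take\<close> applies. If
  the block would exceed the list, truncated subtraction leaves nothing.\<close>

lemma cov_snoc_greedy:
  assumes "sorted_wrt (\<ge>) xs" "xs \<noteq> []" "e \<le> last xs"
  shows "cov (es @ [e]) xs \<longleftrightarrow> cov es (take (length xs - (last xs - e)) xs)"
proof
  assume "cov (es @ [e]) xs"
  then obtain k where k: "k \<le> length xs" "k < length xs \<longrightarrow> length xs - k + e \<le> last xs" "cov es (take k xs)"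
    by (auto simp: cov_snoc)
  have "length xs - (last xs - e) \<le> k" using k by (cases "k < length xs") auto
  hence "take (length xs - (last xs - e)) xs = take (length xs - (last xs - e)) (take k xs)"
    by (simp add: min_def)
  thus "cov es (take (length xs - (last xs - e)) xs)"
    using cov_take[OF sorted_wrt_take[OF assms(1)] k(3)] by metis
next
  assume "cov es (take (length xs - (last xs - e)) xs)"
  thus "cov (es @ [e]) xs"
    unfolding cov_snoc using assms(3) by (intro exI[of _ "length xs - (last xs - e)"]) auto
qed

text \<open>A part 1 fits only into a square block of length one, so each entry 0 accounts for at
  most one such part.\<close>

lemma cov_count_ones:
  "sorted_wrt (\<ge>) xs \<Longrightarrow> cov es xs \<Longrightarrow> count_list xs 1 \<le> count_list es 0"
proof (induction es arbitrary: xs)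
  case (Cons e es)
  then obtain d where d: "d \<le> length xs" "0 < d \<longrightarrow> d + e \<le> xs ! (d - 1)" "cov es (drop d xs)"
    by auto
  have IH: "count_list (drop d xs) 1 \<le> count_list es 0"
    using Cons.prems d(3) by (intro Cons.IH) (simp_all add: sorted_wrt_drop)
  have split: "count_list xs 1 = count_list (take d xs) 1 + count_list (drop d xs) 1"
    by (metis append_take_drop_id count_list_append)
  show ?case
  proof (cases "2 \<le> d + e \<and> 0 < d")
    case True
    have "1 \<notin> set (take d xs)"
    proof
      assume "1 \<in> set (take d xs)"
      then obtain k where k: "k < d" "xs ! k = 1" using d(1) by (auto simp: in_set_conv_nth)
      have "xs ! (d - 1) \<le> xs ! k"
        using Cons.prems(1) k d(1) by (intro nth_mono_desc) auto
      thus False using True d(2) k by auto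
    qed
    thus ?thesis using split IH by (simp add: count_list_0_iff)
  next
    case False
    hence "d = 0 \<or> d = 1 \<and> e = 0" by auto
    thus ?thesis
    proof
      assume "d = 1 \<and> e = 0"
      moreover have "count_list (take d xs) 1 \<le> length (take d xs)" by (rule count_le_length)
      ultimately show ?thesis using split IH by simp
    qed (use IH in auto)
  qed
qed simp

lemma cov_length: "cov es xs \<Longrightarrow> \<forall>x\<in>set xs. x \<le> M \<Longrightarrow> length xs \<le> length es * M"
proof (induction es arbitrary: xs)
  case (Cons e es)
  then obtain d where d: "d \<le> length xs" "0 < d \<longrightarrow> d + e \<le> xs ! (d - 1)" "cov es (drop d xs)"
    by auto
  have "length (drop d xs) \<le> length es * M"
    using Cons.prems(2) by (intro Cons.IH d(3)) (auto dest: in_set_dropD)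
  moreover have "d \<le> M"
  proof (cases "d = 0")
    case False
    hence "xs ! (d - 1) \<in> set xs" using d(1) by simp
    thus ?thesis using Cons.prems(2) d(2) False by fastforce
  qed simp
  ultimately show ?case by simp
qed simp

section \<open>The condition defining \<open>C\<close>\<close>

text \<open>Block \<open>i\<close> itself is rectangular: the correction \<open>l - i\<close> in
  \<open>p_val\<close> first shows at \<open>l = i + 1\<close>, after block \<open>i\<close> was
  removed with one part fewer.\<close>

definition block_type :: "nat \<Rightarrow> nat \<Rightarrow> nat" where
  "block_type i l = (if l < i then 0 else 1)"

lemma rev_block_types:
  assumes "1 \<le> i" "i \<le> r"
  shows "rev (map (block_type i) [1..<r]) = replicate (r - i) 1 @ replicate (i - 1) 0"
proof -
  have "[1..<r] = [1..<i] @ [i..<r]" using assms by (metis upt_add_eq_append le_add_diff_inverse)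
  moreover have "map (block_type i) [1..<i] = replicate (i - 1) 0"
    by (rule replicate_eqI) (auto simp: block_type_def)
  moreover have "map (block_type i) [i..<r] = replicate (r - i) 1"
    by (rule replicate_eqI) (auto simp: block_type_def)
  ultimately show ?thesis by simp
qed

text \<open>The numbers \<open>p_val\<close> are the smallest parts met when
  \<open>cov_snoc_greedy\<close> is iterated from the small end.\<close>

lemma in_C_iff_cov:
  assumes "2 \<le> r" "1 \<le> i" "i \<le> r"
    and xs: "sorted_wrt (\<ge>) xs" "\<forall>x\<in>set xs. 0 < x"
  shows "in_C r i xs \<longleftrightarrow> cov (replicate (r - i) 1 @ replicate (i - 1) 0) xs"
proof -
  define p where "p = p_val i xs"
  \<comment> \<open>The number of parts left before block \<open>l\<close>, possibly negative.
    Truncated \<open>l - i\<close> is 0 for \<open>l <= i\<close> and so merges the two cases of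
    \<open>p_val\<close>.\<close>
  define m where "m = (\<lambda>l. int (length xs) - int (\<Sum>j\<in>{1..<l}. p j) + int (l - i))"
  define es where "es = (\<lambda>l. rev (map (block_type i) [l..<r]))"
  have part_pos: "part xs j = 0 \<longleftrightarrow> j < 1" if "j \<le> int (length xs)" for j
  proof (cases "1 \<le> j")
    case True
    hence "xs ! nat (j - 1) \<in> set xs" using that by (intro nth_mem) linarith
    thus ?thesis using True that xs(2) by (simp add: part_def)
  qed (simp add: part_def)
  have p: "p l = part xs (m l)" if "1 \<le> l" "\<forall>j\<in>{1..<l}. p j \<noteq> 0" for l
    using that assms(2) unfolding p_def m_def
    by (subst p_val.simps) (auto simp: of_nat_diff algebra_simps)
  have inv: "m l \<le> int (length xs) \<and> (cov (es 1) xs \<longleftrightarrow> cov (es l) (take (nat (m l)) xs))"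
    if "1 \<le> l" "l \<le> r" "\<forall>j\<in>{1..<l}. p j \<noteq> 0" for l
    using that
  proof (induction l rule: dec_induct)
    case base
    then show ?case using assms(2) by (simp add: m_def)
  next
    case (step l)
    have IH: "m l \<le> int (length xs)" "cov (es 1) xs \<longleftrightarrow> cov (es l) (take (nat (m l)) xs)"
      using step.IH step.prems by auto
    have pl: "p l = part xs (m l)" using step.hyps step.prems by (intro p) auto
    have "p l \<noteq> 0" using step.prems step.hyps by auto
    hence ml: "1 \<le> m l" using part_pos[OF IH(1)] pl by auto
    have mSuc: "m (Suc l) = m l - int (p l) + int (block_type i l)"
      using step.hyps assms(2) by (auto simp: m_def block_type_def)
    let ?ys = "take (nat (m l)) xs"
    have len: "length ?ys = nat (m l)" using IH(1) by simp
    have "last ?ys = ?ys ! (length ?ys - 1)"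
      using len ml by (intro last_conv_nth) auto
    also have "\<dots> = p l"
      unfolding len using ml IH(1) by (simp add: pl part_def nat_diff_distrib)
    finally have last: "last ?ys = p l" .
    have e: "block_type i l \<le> p l" using \<open>p l \<noteq> 0\<close> by (simp add: block_type_def)
    have "es l = es (Suc l) @ [block_type i l]"
      using step.prems by (simp add: es_def upt_conv_Cons)
    moreover have "?ys \<noteq> []" using ml IH(1) by auto
    ultimately have "cov (es l) ?ys \<longleftrightarrow> cov (es (Suc l)) (take (nat (m l) - (p l - block_type i l)) ?ys)"
      using cov_snoc_greedy[OF sorted_wrt_take[OF xs(1)], of "nat (m l)" "block_type i l" "es (Suc l)"] e
      unfolding last len by simp
    also have "take (nat (m l) - (p l - block_type i l)) ?ys = take (nat (m (Suc l))) xs"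
    proof -
      have "nat (m (Suc l)) = nat (m l) - (p l - block_type i l)"
        unfolding mSuc using e ml by linarith
      thus ?thesis by (simp add: min_def)
    qed
    finally show ?case using IH e unfolding mSuc by auto
  qed
  have "cov (es 1) xs \<longleftrightarrow> N_val r i xs < r - 1 \<or> N_val r i xs = r - 1 \<and>
      int (length xs) \<le> int (\<Sum>j\<in>{1..r - 1}. p_val i xs j) - (int r - int i)"
  proof (cases "\<forall>j\<in>{1..<r}. p j \<noteq> 0")
    case True
    have "{1..r - 1} = {1..<r}" using assms(1) by auto
    moreover have "{l \<in> {1..<r}. p_val i xs l \<noteq> 0} = {1..<r}" using True by (auto simp: p_def)
    ultimately have "N_val r i xs = r - 1" by (simp add: N_val_def)
    moreover have "xs \<noteq> []"
    proof
      assume "xs = []"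
      hence "p 1 = 0" using p[of 1] by (simp add: part_def)
      thus False using True assms(1) by auto
    qed
    \<comment> \<open>At \<open>l = r\<close> no block remains, so a covering exists iff
      \<open>m r <= 0\<close>, which is the length inequality in \<open>in_C\<close>.\<close>
    ultimately show ?thesis
      using inv[of r] True assms \<open>{1..r - 1} = {1..<r}\<close> by (auto simp: es_def m_def p_def)
  next
    case False
    define l where "l = (LEAST l. 1 \<le> l \<and> p l = 0)"
    obtain l0 where l0: "1 \<le> l0" "l0 < r" "p l0 = 0" using False by auto
    have l: "1 \<le> l" "p l = 0" "l < r"
      using LeastI[of "\<lambda>l. 1 \<le> l \<and> p l = 0" l0] Least_le[of "\<lambda>l. 1 \<le> l \<and> p l = 0" l0] l0
      unfolding l_def by auto
    have nz: "\<forall>j\<in>{1..<l}. p j \<noteq> 0"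
      using not_less_Least[of _ "\<lambda>l. 1 \<le> l \<and> p l = 0"] unfolding l_def by fastforce
    \<comment> \<open>A vanishing value of \<open>p\<close> means that the position has run off the
      front of the list: every part is already covered.\<close>
    have "m l < 1" using part_pos[of "m l"] inv[of l] p[of l] l nz by auto
    hence "cov (es 1) xs" using inv[of l] l nz by simp
    moreover have "N_val r i xs < r - 1"
    proof -
      have "l \<in> {1..r - 1}" "l \<notin> {l \<in> {1..r - 1}. p_val i xs l \<noteq> 0}" using l by (auto simp: p_def)
      hence "{l \<in> {1..r - 1}. p_val i xs l \<noteq> 0} \<subset> {1..r - 1}" by blast
      hence "N_val r i xs < card {1..r - 1}" unfolding N_val_def by (intro psubset_card_mono) auto
      thus ?thesis by simp
    qed
    ultimately show ?thesis by simp
  qed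
  moreover have "es 1 = replicate (r - i) 1 @ replicate (i - 1) 0"
    unfolding es_def using assms by (intro rev_block_types)
  moreover have "count_list xs 1 \<le> i - 1" if "cov (replicate (r - i) 1 @ replicate (i - 1) 0) xs"
  proof -
    have "count_list (replicate a b) c = (if b = c then a else 0)" for a and b c :: nat
      by (induction a) auto
    thus ?thesis using cov_count_ones[OF xs(1) that] by simp
  qed
  ultimately show ?thesis by (auto simp: in_C_def)
qed

section \<open>The generating function of \<open>C\<close>\<close>

definition wt :: "nat list \<Rightarrow> int fps" where
  "wt xs = fps_X ^ sum_list xs"

lemma wt_append: "wt (xs @ ys) = wt xs * wt ys"
  by (simp add: wt_def power_add)

lemma wt_Cons: "wt (x # xs) = fps_X ^ x * wt xs"
  by (simp add: wt_def power_add)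

lemma sum_wt_nth:
  assumes "finite A"
  shows "(\<Sum>xs\<in>A. wt xs) $ n = int (card {xs \<in> A. sum_list xs = n})"
proof -
  have "(\<Sum>xs\<in>A. wt xs) $ n = (\<Sum>xs\<in>A. if sum_list xs = n then 1 else 0)"
    unfolding fps_sum_nth by (rule sum.cong) (auto simp: wt_def)
  also have "\<dots> = int (card {xs \<in> A. sum_list xs = n})"
    using assms by (simp add: sum.If_cases Int_def)
  finally show ?thesis .
qed

section \<open>Partitions in a box and Durfee rectangles\<close>

definition box :: "nat \<Rightarrow> nat \<Rightarrow> nat \<Rightarrow> nat list set" where
  "box d lo hi = {xs. sorted_wrt (\<ge>) xs \<and> length xs = d \<and> (\<forall>x\<in>set xs. lo \<le> x \<and> x \<le> hi)}"

lemma finite_box: "finite (box d lo hi)"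
  by (rule finite_subset[OF _ finite_lists_length_eq[of "{lo..hi}" d]]) (auto simp: box_def)

lemma box_Suc:
  "lo \<le> hi \<Longrightarrow> box (Suc d) lo hi = {xs \<in> box (Suc d) lo hi. hd xs < hi} \<union> Cons hi ` box d lo hi"
proof (intro equalityI subsetI)
  fix xs assume xs: "xs \<in> box (Suc d) lo hi"
  then obtain y ys where ys: "xs = y # ys" by (cases xs) (auto simp: box_def)
  show "xs \<in> {xs \<in> box (Suc d) lo hi. hd xs < hi} \<union> Cons hi ` box d lo hi"
    using xs unfolding ys by (cases "y < hi") (auto simp: box_def)
qed (auto simp: box_def)

text \<open>Distinguishing whether the largest part attains the upper bound gives the second
  q-Pascal rule.\<close>

lemma sum_box: "(\<Sum>xs\<in>box d lo (lo + h). wt xs) = fps_X ^ (d * lo) * qbin fps_X (d + h) d"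
proof (induction d arbitrary: h)
  case 0
  have "box 0 lo (lo + h) = {[]}" by (auto simp: box_def)
  then show ?case by (simp add: wt_def)
next
  case (Suc d)
  have step: "(\<Sum>xs\<in>box (Suc d) lo (lo + h). wt xs) =
      (\<Sum>xs\<in>{xs \<in> box (Suc d) lo (lo + h). hd xs < lo + h}. wt xs)
      + fps_X ^ (lo + h) * (fps_X ^ (d * lo) * qbin fps_X (d + h) d)" for h
  proof -
    have "(\<Sum>xs\<in>box (Suc d) lo (lo + h). wt xs) = (\<Sum>xs\<in>{xs \<in> box (Suc d) lo (lo + h). hd xs < lo + h}. wt xs)
        + (\<Sum>xs\<in>Cons (lo + h) ` box d lo (lo + h). wt xs)"
      by (subst box_Suc, simp, rule sum.union_disjoint) (auto simp: finite_box)
    also have "(\<Sum>xs\<in>Cons (lo + h) ` box d lo (lo + h). wt xs) = fps_X ^ (lo + h) * (\<Sum>xs\<in>box d lo (lo + h). wt xs)"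
      by (simp add: sum.reindex wt_Cons sum_distrib_left)
    finally show ?thesis unfolding Suc.IH .
  qed
  show ?case
  proof (induction h)
    case 0
    have empty: "{xs \<in> box (Suc d) lo (lo + 0). hd xs < lo + 0} = {}"
      by (auto simp: box_def length_Suc_conv)
    show ?case using step[of 0] unfolding empty by (simp add: power_add)
  next
    case (Suc h)
    have "{xs \<in> box (Suc d) lo (lo + Suc h). hd xs < lo + Suc h} = box (Suc d) lo (lo + h)"
      by (auto simp: box_def length_Suc_conv less_Suc_eq_le) (meson le_trans)
    hence "(\<Sum>xs\<in>box (Suc d) lo (lo + Suc h). wt xs) = fps_X ^ (Suc d * lo) * qbin fps_X (Suc d + h) (Suc d)
        + fps_X ^ (lo + Suc h) * (fps_X ^ (d * lo) * qbin fps_X (d + Suc h) d)"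
      using step[of "Suc h"] Suc.IH by simp
    also have "\<dots> = fps_X ^ (Suc d * lo) * qbin fps_X (Suc (d + Suc h)) (Suc d)"
      by (subst qbin_Suc_Suc) (simp_all add: power_add algebra_simps)
    finally show ?case by simp
  qed
qed

definition cov_set :: "nat list \<Rightarrow> nat \<Rightarrow> nat list set" where
  "cov_set es M = {xs. sorted_wrt (\<ge>) xs \<and> (\<forall>x\<in>set xs. 0 < x \<and> x \<le> M) \<and> cov es xs}"

definition cov_ser :: "nat list \<Rightarrow> nat \<Rightarrow> int fps" where
  "cov_ser es M = (\<Sum>xs\<in>cov_set es M. wt xs)"

lemma finite_cov_set: "finite (cov_set es M)"
  by (rule finite_subset[OF _ finite_lists_length_le[of "{..M}" "length es * M"]])
     (auto simp: cov_set_def cov_length)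

text \<open>Here \<open>d\<close> is the largest admissible length of the first block, the side of
  the Durfee square or rectangle. The parts behind it are then at most \<open>d + e\<close>, and
  this determines \<open>d\<close>.\<close>

lemma bij_betw_durfee:
  "bij_betw (\<lambda>(d, ys, zs). ys @ zs)
     (SIGMA d:{..M}. box d (d + e) (M + e) \<times> cov_set es (d + e)) (cov_set (e # es) (M + e))"
proof (rule bij_betwI')
  fix a b
  assume a: "a \<in> (SIGMA d:{..M}. box d (d + e) (M + e) \<times> cov_set es (d + e))"
    and b: "b \<in> (SIGMA d:{..M}. box d (d + e) (M + e) \<times> cov_set es (d + e))"
  \<comment> \<open>If \<open>d < d'\<close>, the part at position \<open>d\<close> would be at most
    \<open>d + e\<close> and at least \<open>d' + e\<close>.\<close>
  have le: "d' \<le> d"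
    if "ys \<in> box d (d + e) (M + e)" "zs \<in> cov_set es (d + e)" "ys' \<in> box d' (d' + e) (M + e)"
      "ys @ zs = ys' @ zs'" for d d' ys ys' zs zs'
  proof (rule ccontr)
    assume "\<not> d' \<le> d"
    hence "d < d'" by simp
    have len: "length ys = d" "length ys' = d'" using that by (auto simp: box_def)
    have "(ys @ zs) ! d = ys' ! d" unfolding that(4) using len \<open>d < d'\<close> by (simp add: nth_append)
    moreover have "d < length (ys @ zs)" unfolding that(4) using len \<open>d < d'\<close> by simp
    ultimately have "zs ! 0 = ys' ! d" "0 < length zs" using len by (auto simp: nth_append)
    hence "ys' ! d \<le> d + e" using that(2) nth_mem[of 0 zs] by (auto simp: cov_set_def)
    moreover have "d' + e \<le> ys' ! d" using that(3) len \<open>d < d'\<close> nth_mem[of d ys'] by (auto simp: box_def)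
    ultimately show False using \<open>d < d'\<close> by simp
  qed
  obtain d ys zs d' ys' zs' where ab: "a = (d, ys, zs)" "b = (d', ys', zs')" by (metis prod_cases3)
  show "((case a of (d, ys, zs) \<Rightarrow> ys @ zs) = (case b of (d, ys, zs) \<Rightarrow> ys @ zs)) = (a = b)"
  proof
    assume "(case a of (d, ys, zs) \<Rightarrow> ys @ zs) = (case b of (d, ys, zs) \<Rightarrow> ys @ zs)"
    hence eq: "ys @ zs = ys' @ zs'" by (simp add: ab)
    have "d = d'" using a b le[OF _ _ _ eq] le[OF _ _ _ eq[symmetric]] by (auto simp: ab intro: antisym)
    moreover have "length ys = d" "length ys' = d'" using a b by (auto simp: ab box_def)
    ultimately show "a = b" using eq by (simp add: ab)
  qed simp
next
  fix a
  assume "a \<in> (SIGMA d:{..M}. box d (d + e) (M + e) \<times> cov_set es (d + e))"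
  then obtain d ys zs where a: "a = (d, ys, zs)" "d \<le> M" and ys: "ys \<in> box d (d + e) (M + e)"
    and zs: "zs \<in> cov_set es (d + e)" by auto
  have "\<exists>k\<le>length (ys @ zs). (0 < k \<longrightarrow> k + e \<le> (ys @ zs) ! (k - 1)) \<and> cov es (drop k (ys @ zs))"
  proof (intro exI[of _ d] conjI impI)
    show "d + e \<le> (ys @ zs) ! (d - 1)" if "0 < d"
    proof -
      have "ys ! (d - 1) \<in> set ys" using that ys by (intro nth_mem) (auto simp: box_def)
      thus ?thesis using that ys by (auto simp: box_def nth_append)
    qed
  qed (use ys zs in \<open>auto simp: box_def cov_set_def\<close>)
  moreover have "0 < x" if "x \<in> set ys" for x
  proof -
    have "0 < d" "d + e \<le> x" using that ys by (auto simp: box_def)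
    thus ?thesis by simp
  qed
  moreover have "sorted_wrt (\<ge>) (ys @ zs)"
    using ys zs by (fastforce simp: box_def cov_set_def sorted_wrt_append)
  ultimately show "(case a of (d, ys, zs) \<Rightarrow> ys @ zs) \<in> cov_set (e # es) (M + e)"
    using ys zs a by (fastforce simp: box_def cov_set_def)
next
  fix xs
  assume "xs \<in> cov_set (e # es) (M + e)"
  hence xs: "sorted_wrt (\<ge>) xs" "\<forall>x\<in>set xs. 0 < x \<and> x \<le> M + e" "cov (e # es) xs"
    by (auto simp: cov_set_def)
  define D where "D = {d. d \<le> length xs \<and> (0 < d \<longrightarrow> d + e \<le> xs ! (d - 1))}"
  obtain d0 where d0: "d0 \<in> D" "cov es (drop d0 xs)" using xs(3) by (auto simp: D_def)
  have "finite D" by (simp add: D_def)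
  \<comment> \<open>The block of some covering is enlarged to the maximal one;
    \<open>cov_drop\<close> keeps the rest coverable.\<close>
  define d where "d = Max D"
  have "d \<in> D" using \<open>finite D\<close> d0 unfolding d_def by (intro Max_in) auto
  hence d: "d \<le> length xs" "0 < d \<longrightarrow> d + e \<le> xs ! (d - 1)" by (auto simp: D_def)
  have "d0 \<le> d" using \<open>finite D\<close> d0 by (simp add: d_def)
  hence "drop d xs = drop (d - d0) (drop d0 xs)" by simp
  hence cov: "cov es (drop d xs)" using cov_drop[OF d0(2)] by metis
  have "d \<le> M"
  proof (cases "d = 0")
    case False
    hence "xs ! (d - 1) \<in> set xs" using d(1) by simp
    hence "xs ! (d - 1) \<le> M + e" using xs(2) by blast
    thus ?thesis using d(2) False by simp
  qed simp
  moreover have "take d xs \<in> box d (d + e) (M + e)"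
  proof -
    have "d + e \<le> x" if x: "x \<in> set (take d xs)" for x
    proof -
      obtain k where k: "k < d" "x = xs ! k" using x d(1) by (auto simp: in_set_conv_nth)
      have "xs ! (d - 1) \<le> xs ! k" using k d(1) xs(1) by (intro nth_mono_desc) auto
      thus ?thesis using k d(2) by auto
    qed
    thus ?thesis using xs d(1) by (auto simp: box_def sorted_wrt_take dest: in_set_takeD)
  qed
  moreover have "drop d xs \<in> cov_set es (d + e)"
  proof -
    have "x \<le> d + e" if x: "x \<in> set (drop d xs)" for x
    proof -
      obtain k where "k < length (drop d xs)" "drop d xs ! k = x"
        using x by (metis in_set_conv_nth)
      hence k: "d + k < length xs" "x = xs ! (d + k)" by auto
      have "Suc d \<notin> D" using Max_ge[OF \<open>finite D\<close>, of "Suc d"] unfolding d_def by auto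
      hence "xs ! d \<le> d + e" using k by (auto simp: D_def)
      moreover have "xs ! (d + k) \<le> xs ! d" using k xs(1) by (intro nth_mono_desc) auto
      ultimately show ?thesis using k by simp
    qed
    thus ?thesis using xs cov by (auto simp: cov_set_def sorted_wrt_drop dest: in_set_dropD)
  qed
  ultimately show "\<exists>a\<in>SIGMA d:{..M}. box d (d + e) (M + e) \<times> cov_set es (d + e).
      xs = (case a of (d, ys, zs) \<Rightarrow> ys @ zs)"
    by (intro bexI[of _ "(d, take d xs, drop d xs)"]) auto
qed

lemma cov_ser_Cons:
  "cov_ser (e # es) (M + e) = Sop e (\<lambda>d. cov_ser es (d + e)) M"
proof -
  have "cov_ser (e # es) (M + e) =
      (\<Sum>(d, ys, zs)\<in>(SIGMA d:{..M}. box d (d + e) (M + e) \<times> cov_set es (d + e)). wt (ys @ zs))"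
    unfolding cov_ser_def sum.reindex_bij_betw[OF bij_betw_durfee, symmetric] by (simp add: case_prod_unfold)
  also have "\<dots> = (\<Sum>d\<le>M. \<Sum>(ys, zs)\<in>box d (d + e) (M + e) \<times> cov_set es (d + e). wt (ys @ zs))"
    by (subst sum.Sigma) (auto simp: finite_box finite_cov_set case_prod_unfold)
  also have "\<dots> = (\<Sum>d\<le>M. (\<Sum>ys\<in>box d (d + e) (M + e). wt ys) * cov_ser es (d + e))"
    unfolding wt_append cov_ser_def sum_product sum.cartesian_product ..
  also have "\<dots> = Sop e (\<lambda>d. cov_ser es (d + e)) M"
    unfolding Sop_def
  proof (rule sum.cong)
    fix d assume "d \<in> {..M}"
    then obtain h where h: "M = d + h" by (auto simp: le_iff_add)
    have "M + e = d + e + h" by (simp add: h)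
    thus "(\<Sum>ys\<in>box d (d + e) (M + e). wt ys) * cov_ser es (d + e) =
        fps_X ^ (d\<^sup>2 + e * d) * qbin fps_X M d * cov_ser es (d + e)"
      using sum_box[of d "d + e" h] by (simp add: h power2_eq_square algebra_simps)
  qed simp
  finally show ?thesis .
qed

lemma cov_ser_Nil: "cov_ser [] M = 1"
proof -
  have "cov_set [] M = {[]}" by (auto simp: cov_set_def)
  thus ?thesis by (simp add: cov_ser_def wt_def)
qed

lemma cov_ser_squares: "cov_ser (replicate k 0) = (Sop 0 ^^ k) (\<lambda>_. 1)"
proof (induction k)
  case (Suc k)
  show ?case using cov_ser_Cons[of 0 "replicate k 0"] by (auto simp: Suc)
qed (auto simp: cov_ser_Nil)

lemma cov_ser_rectangles:
  "(\<lambda>M. cov_ser (replicate k 1 @ es) (Suc M)) = (Sop 1 ^^ k) (\<lambda>M. cov_ser es (Suc M))"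
proof (induction k)
  case (Suc k)
  show ?case using cov_ser_Cons[of 1 "replicate k 1 @ es"] Suc by auto
qed simp

lemma C_count_eq:
  assumes "2 \<le> r" "1 \<le> i" "i \<le> r"
  shows "int (C_count r i n) = C_ser r i 0 $ n"
proof -
  define es :: "nat list" where "es = replicate (r - i) 1 @ replicate (i - 1) 0"
  have "C_ser r i 0 = flim (\<lambda>M. cov_ser es (Suc M))"
    using assms(2) unfolding C_ser_def es_def cov_ser_rectangles cov_ser_squares by (cases i) auto
  hence "C_ser r i 0 $ n = cov_ser es (Suc n) $ n"
    by (simp add: flim_def)
  also have "\<dots> = int (card {xs \<in> cov_set es (Suc n). sum_list xs = n})"
    unfolding cov_ser_def by (rule sum_wt_nth[OF finite_cov_set])
  \<comment> \<open>Parts of a partition of \<open>n\<close> are at most \<open>n\<close>, so the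
    bound \<open>Suc n\<close> coming from the diagonal in \<open>flim\<close> excludes
    nothing.\<close>
  also have "{xs \<in> cov_set es (Suc n). sum_list xs = n} = {xs. partition_of n xs \<and> in_C r i xs}"
    using in_C_iff_cov[OF assms] unfolding es_def[symmetric]
    by (auto simp: cov_set_def partition_of_def le_SucI[OF member_le_sum_list])
  finally show ?thesis by (simp add: C_count_def)
qed

theorem theorem1p4:
  fixes r i n :: nat
  assumes "r \<ge> 2" and "1 \<le> i" and "i \<le> r"
  shows "C_count r i n = T_count r i n \<and> T_count r i n = E_count r i n"
proof
  have "int (C_count r i n) = int (T_count r i n)"
    using assms by (simp add: C_count_eq T_count_eq C_ser_eq_T_ser)
  thus "C_count r i n = T_count r i n" by simp
  show "T_count r i n = E_count r i n"
    using assms by (intro T_count_eq_E_count) auto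
qed

end
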